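(* Consider the Bradley–Terry–Luce (BTL) model with parameter $\boldsymbol\theta^*=(\theta_1^*,\dots,\theta_n^* )^\top$ such that $\mathbf 1_n^\top\boldsymbol\theta^*=0$ and a comparison graph $\mathcal G=\mathcal G([n],E)$ with adjacency matrix $\mathbf A$, algebraic connectivity $\lambda_2=\lambda_2(\mathcal L_{\mathbf A})$ and maximum and minimum degrees $n_{\max}$ and $n_{\min}$. Suppose that each pair of items $(i,j)\in E$ is compared $L$ times. Let $\kappa=\max_{i,j}|\theta_i^*-\theta_j^*|$ and $\kappa_E=\max_{(i,j)\in E}|\theta_i^*-\theta_j^*|$. Assume that $\mathcal G$ is connected, or equivalently $\lambda_2(\mathcal L_{\mathbf A})>0$. In addition, assume that 1. $\lambda_2(\mathcal L_{\mathbf A})^2L>Ce^{2\kappa_E}\max\left\{n_{\max}\log n,\ e^{2\kappa_E}n\frac{n_{\max}^2}{n_{\min}^2}\right\}$ for some large constant $C>0$, and 2. $\lambda_2(\mathcal L_{\mathbf A})\ge2e^{2\kappa_E}n_{\max}/n_{\min}$. Then, provided that $L\lesssim n^5$, $\kappa<n$, $\kappa_E\le\log n$, and the right hand side of (1) below is smaller than a sufficiently small constant, with probability at least $1-O(n^{-5})$ the unregularized MLE $\hat{\boldsymbol\theta}$ satisfies $$\|\hat{\boldsymbol\theta}-\boldsymbol\theta^*\|_\infty\lesssim e^{\kappa_E}\sqrt{\frac{n_{\max}\log n}{Ln_{\min}^2}}+s\sqrt{\frac{n_{\max}}{L}}\left[1+\frac{e^{\kappa_E}\sqrt{\log n}}{n_{\min}}+s\sqrt{\frac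 n{n_{\max}}}\right],\qquad(1)$$ where $s=\frac{e^{2\kappa_E}n_{\max}}{\lambda_2n_{\min}}$, and $$\|\hat{\boldsymbol\theta}-\boldsymbol\theta^*\|_2\lesssim\frac{e^{\kappa_E}}{\lambda_2(\mathcal L_{\mathbf A})}\sqrt{\frac{n_{\max}n}{L}}.$$
   Context: The comparison graph is an undirected simple graph on $[n]=\{1,\dots,n\}$, $A_{ij}=1\{(i,j)\in E\}$, degrees $n_i=\sum_jA_{ij}$, $n_{\max}=\max_in_i$, $n_{\min}=\min_in_i$. The Laplacian is $\mathcal L_{\mathbf A}=\mathrm{diag}(n_1,\dots,n_n)-\mathbf A$, and $\lambda_2(\mathcal L_{\mathbf A})$ is its second smallest eigenvalue. BTL model: for each edge $(i,j)\in E$, $i<j$, one observes independent $y_{ij}^{(l)}\in\{0,1\}$, $l=1,\dots,L$, with $\Pr(y_{ij}^{(l)}=1)=\psi(\theta_i^*-\theta_j^* )$, $\psi(t)=1/(1+e^{-t})$; all comparisons are independent. Put $\bar y_{ij}=\frac1L\sum_ly_{ij}^{(l)}$. The unregularized (vanilla) MLE is $\hat{\boldsymbol\theta}=\arg\min_{\boldsymbol\theta\in\mathbb R^n:\mathbf 1_n^\top\boldsymbol\theta=0}\ell(\boldsymbol\theta;\mathbf y)$ with $$\ell(\boldsymbol\theta;\mathbf y)=-\sum_{1\le i<j\le n}A_{ij}\left\{\bar y_{ij}\log\psi(\theta_i-\theta_j)+(1-\bar y_{ij})\log[1-\psi(\theta_i-\theta_j)]\right\}.$$ $\mathbf 1_n$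 is the all-ones vector. $x\lesssim y$ means $x\le cy$ for a constant $c>0$ not depending on $n,L,\mathcal G,\boldsymbol\theta^*$; likewise for $O(\cdot)$. *)

theory Defs
  imports
    "HOL-Probability.Product_PMF"
    "HOL-Analysis.L2_Norm"
    "Jordan_Normal_Form.Char_Poly"
begin

(* Items are numbered 0,...,n-1 instead of 1,...,n, to agree with the indexing of matrices.
   An undirected simple graph is a symmetric irreflexive relation, so every edge occurs in E
   as both (i,j) and (j,i). *)

definition simple_graph :: "nat \<Rightarrow> (nat \<times> nat) set \<Rightarrow> bool" where
  "simple_graph n E \<longleftrightarrow> E \<subseteq> {..<n} \<times> {..<n} \<and> sym E \<and> irrefl E"

definition connected_graph :: "nat \<Rightarrow> (nat \<times> nat) set \<Rightarrow> bool" where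
  "connected_graph n E \<longleftrightarrow> (\<forall>i<n. \<forall>j<n. (i, j) \<in> E\<^sup>*)"

definition adj :: "(nat \<times> nat) set \<Rightarrow> nat \<Rightarrow> nat \<Rightarrow> real" where
  "adj E i j = of_bool ((i, j) \<in> E)"

definition degree_of :: "nat \<Rightarrow> (nat \<times> nat) set \<Rightarrow> nat \<Rightarrow> real" where
  "degree_of n E i = (\<Sum>j<n. adj E i j)"

definition n_max :: "nat \<Rightarrow> (nat \<times> nat) set \<Rightarrow> real" where
  "n_max n E = Max (degree_of n E ` {..<n})"

definition n_min :: "nat \<Rightarrow> (nat \<times> nat) set \<Rightarrow> real" where
  "n_min n E = Min (degree_of n E ` {..<n})"

definition laplacian :: "nat \<Rightarrow> (nat \<times> nat) set \<Rightarrow> real mat" where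
  "laplacian n E = mat_diag n (degree_of n E) - Matrix.mat n n (\<lambda>(i, j). adj E i j)"

(* The Laplacian is symmetric, so its characteristic polynomial has n real roots; they are
   listed in increasing order with multiplicity, and entry 1 is the second smallest. *)
definition lambda2 :: "nat \<Rightarrow> (nat \<times> nat) set \<Rightarrow> real" where
  "lambda2 n E = sorted_list_of_multiset (proots (char_poly (laplacian n E))) ! 1"

definition psi :: "real \<Rightarrow> real" where
  "psi t = 1 / (1 + exp (- t))"

(* Joint law of all comparisons: independent coordinates y (i,j,l), one for each edge with
   i < j and each l < L, with success probability psi (\<theta> i - \<theta> j).  Coordinates outside
   this index set are constantly False. *)
definition btl_pmf ::
  "nat \<Rightarrow> (nat \<times> nat) set \<Rightarrow> nat \<Rightarrow> (nat \<Rightarrow> real) \<Rightarrow> (nat \<times> nat \<times> nat \<Rightarrow> bool) pmf" where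
  "btl_pmf n E L \<theta> =
     Pi_pmf {(i, j, l). i < j \<and> j < n \<and> (i, j) \<in> E \<and> l < L} False
       (\<lambda>(i, j, l). bernoulli_pmf (psi (\<theta> i - \<theta> j)))"

definition ybar :: "nat \<Rightarrow> (nat \<times> nat \<times> nat \<Rightarrow> bool) \<Rightarrow> nat \<Rightarrow> nat \<Rightarrow> real" where
  "ybar L y i j = (1 / real L) * (\<Sum>l<L. of_bool (y (i, j, l)))"

definition neg_loglik ::
  "nat \<Rightarrow> (nat \<times> nat) set \<Rightarrow> nat \<Rightarrow> (nat \<times> nat \<times> nat \<Rightarrow> bool) \<Rightarrow> (nat \<Rightarrow> real) \<Rightarrow> real" where
  "neg_loglik n E L y \<theta> =
     - (\<Sum>(i, j)\<in>{(i, j). i < j \<and> j < n}.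
          adj E i j * (ybar L y i j * ln (psi (\<theta> i - \<theta> j))
                       + (1 - ybar L y i j) * ln (1 - psi (\<theta> i - \<theta> j))))"

(* Vectors in R^n are functions on nat of which only the values at 0,...,n-1 matter. *)
definition is_mle ::
  "nat \<Rightarrow> (nat \<times> nat) set \<Rightarrow> nat \<Rightarrow> (nat \<times> nat \<times> nat \<Rightarrow> bool) \<Rightarrow> (nat \<Rightarrow> real) \<Rightarrow> bool" where
  "is_mle n E L y \<theta> \<longleftrightarrow> is_arg_min (neg_loglik n E L y) (\<lambda>\<theta>. (\<Sum>i<n. \<theta> i) = 0) \<theta>"

definition kappa :: "nat \<Rightarrow> (nat \<Rightarrow> real) \<Rightarrow> real" where
  "kappa n \<theta> = Max ((\<lambda>(i, j). \<bar>\<theta> i - \<theta> j\<bar>) ` ({..<n} \<times> {..<n}))"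

definition kappa_E :: "(nat \<times> nat) set \<Rightarrow> (nat \<Rightarrow> real) \<Rightarrow> real" where
  "kappa_E E \<theta> = Max ((\<lambda>(i, j). \<bar>\<theta> i - \<theta> j\<bar>) ` E)"

definition linf_dist :: "nat \<Rightarrow> (nat \<Rightarrow> real) \<Rightarrow> (nat \<Rightarrow> real) \<Rightarrow> real" where
  "linf_dist n \<theta> \<theta>' = Max ((\<lambda>i. \<bar>\<theta> i - \<theta>' i\<bar>) ` {..<n})"

definition l2_dist :: "nat \<Rightarrow> (nat \<Rightarrow> real) \<Rightarrow> (nat \<Rightarrow> real) \<Rightarrow> real" where
  "l2_dist n \<theta> \<theta>' = L2_set (\<lambda>i. \<theta> i - \<theta>' i) {..<n}"

definition s_ratio :: "nat \<Rightarrow> (nat \<times> nat) set \<Rightarrow> (nat \<Rightarrow> real) \<Rightarrow> real" where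
  "s_ratio n E \<theta> = exp (2 * kappa_E E \<theta>) * n_max n E / (lambda2 n E * n_min n E)"

definition linf_rate :: "nat \<Rightarrow> (nat \<times> nat) set \<Rightarrow> nat \<Rightarrow> (nat \<Rightarrow> real) \<Rightarrow> real" where
  "linf_rate n E L \<theta> =
     exp (kappa_E E \<theta>) * sqrt (n_max n E * ln (real n) / (real L * (n_min n E)\<^sup>2))
     + s_ratio n E \<theta> * sqrt (n_max n E / real L)
       * (1 + exp (kappa_E E \<theta>) * sqrt (ln (real n)) / n_min n E
            + s_ratio n E \<theta> * sqrt (real n / n_max n E))"

definition l2_rate :: "nat \<Rightarrow> (nat \<times> nat) set \<Rightarrow> nat \<Rightarrow> (nat \<Rightarrow> real) \<Rightarrow> real" where
  "l2_rate n E L \<theta> =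
     exp (kappa_E E \<theta>) / lambda2 n E * sqrt (n_max n E * real n / real L)"

end

theory Submission
  imports Defs "HOL-Probability.Hoeffding" "HOL-Probability.Distributions"
begin

text \<open>
  Write a parameter as \<open>\<theta> + d\<close>, where \<open>\<theta>\<close> is the true one and \<open>d\<close> is centred, that is, sums to zero.
  On an edge \<open>e = (i, j)\<close> put \<open>grad x e = x i - x j\<close>, let \<open>\<beta> e\<close> be the observed frequency of a win
  minus its expectation, and let \<open>w e\<close> be the derivative of the logistic function at \<open>grad \<theta> e\<close>.
  With \<open>H\<close> the graph Laplacian with weights \<open>w\<close> and \<open>divg\<close> the adjoint of \<open>grad\<close>, the gradient of the
  negative log-likelihood vanishes at \<open>\<theta> + d\<close> iff
    \<open>H d = divg (\<beta> - r d)\<close>,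
  where \<open>r d e\<close> is the second-order Taylor remainder of the logistic function.  The derivative
  of the logistic function changes only by a factor close to one under a small shift, so where
  \<open>\<bar>d\<bar> \<le> \<rho>\<close> the map \<open>r\<close> has Lipschitz constant \<open>O(\<rho> w e)\<close> in \<open>grad d e\<close>.  The map that sends \<open>d\<close> to
  the solution \<open>x\<close> of \<open>H x = divg (\<beta> - r d)\<close> is therefore a contraction for the energy norm
  \<open>sqrt (x \<bullet> H x)\<close>, and it has a fixed point as soon as it preserves a set bounded by \<open>\<rho>\<close> in the
  supremum norm and by \<open>2 R\<close> in the energy norm (\<open>nonlinear_poisson_solvable\<close>).  A fixed point is a
  zero of the gradient, and by strict convexity and connectedness it is the one and only maximum
  likelihood estimator (\<open>score_zero_imp_unique_mle\<close>).

  The energy bound is a matter of \<open>divg \<beta>\<close> in the Euclidean norm, which is \<open>O(sqrt (n n_max / L))\<close>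
  without a logarithm and outside an event of probability \<open>exp (- n)\<close>
  (\<open>noise_divg_norm_tail\<close>); it also gives the Euclidean error bound.

  The supremum bound rests on the identity
    \<open>x i = (H x) i / D + q \<bullet> H x\<close>,
  with \<open>D\<close> the weighted degree of \<open>i\<close> and \<open>q\<close> a potential that depends only on \<open>i\<close>, on the graph and on
  \<open>\<theta>\<close>, whose energy is small (\<open>pointwise_test_vector\<close>).  For \<open>H x = divg (\<beta> - r d)\<close> it splits \<open>x i\<close> into
  four parts.  The two parts with \<open>\<beta>\<close> are sums of independent bounded variables with deterministic
  coefficients, so Hoeffding's bound controls them for all \<open>i\<close> at once.  The condition
  \<open>lambda2 \<ge> 2 exp (2 kappa_E) n_max / n_min\<close> gives \<open>q \<bullet> divg \<beta>\<close> and
  \<open>(divg \<beta>) i / D\<close> the same bound \<open>O(exp (2 kappa_E) n_max / (L n_min\<^sup>2))\<close> on their variance proxies, so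
  both parts are of the order \<open>\<epsilon>\<close> of the first summand of the rate.  The two parts with \<open>r\<close> are at most \<open>\<rho> / 4\<close> each: the local one is of order \<open>\<rho>\<^sup>2\<close>, and
  the other one is at most \<open>4 \<rho>\<close> times the product of the energy norms of \<open>q\<close> and \<open>d\<close>, which the
  condition on \<open>lambda2\<^sup>2 L\<close> makes small.  Thus \<open>\<rho> = 24 \<epsilon>\<close> is admissible once \<open>\<epsilon>\<close> is small.

  The definition of the eigenvalue enters through the Poincare inequality
  \<open>lambda2 (\<Sum>i. (x i)\<^sup>2) \<le> (\<Sum>e. (grad x e)\<^sup>2)\<close> for centred \<open>x\<close> (\<open>lambda2_poincare\<close>).
\<close>

section \<open>The logistic function\<close>

definition dpsi :: "real \<Rightarrow> real" where
  "dpsi t = psi t * (1 - psi t)"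

lemma one_plus_exp_pos: "0 < 1 + exp (t::real)"
  by (intro add_pos_pos) auto

lemma one_plus_exp_neq_0 [simp]: "1 + exp (t::real) \<noteq> 0"
  using one_plus_exp_pos[of t] by linarith

lemma psi_eq_exp: "psi t = exp t / (1 + exp t)"
  by (simp add: psi_def exp_minus field_simps)

lemma psi_pos: "0 < psi t" and psi_less_one: "psi t < 1"
  by (simp_all add: psi_eq_exp add_pos_pos divide_less_eq)

lemma psi_has_derivative: "(psi has_real_derivative dpsi t) (at t)"
proof -
  have "((\<lambda>t. 1 / (1 + exp (- t))) has_real_derivative dpsi t) (at t)"
    unfolding dpsi_def psi_def by (auto intro!: derivative_eq_intros simp: field_simps power2_eq_square)
  then show ?thesis by (simp add: psi_def[abs_def])
qed

lemma dpsi_pos: "0 < dpsi t"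
  by (simp add: dpsi_def psi_pos psi_less_one)

lemma dpsi_le_quarter: "dpsi t \<le> 1 / 4"
  using mult_const_minus_self_real_le[of "psi t" 1] by (simp add: dpsi_def)

text \<open>
  This form shows how little the derivative reacts to a shift: the base of the square is
  \<open>2 cosh (t / 2)\<close>, which changes by at most the factor \<open>exp (\<bar>x\<bar> / 2)\<close>.
\<close>
lemma dpsi_eq: "dpsi t = 1 / (exp (t / 2) + exp (- t / 2))\<^sup>2"
proof -
  have e: "exp t = exp (t/2) * exp (t/2)" by (simp flip: exp_add)
  have "1 + exp (t/2) * exp (t/2) \<noteq> 0" using one_plus_exp_neq_0[of t] by (simp add: e)
  then show ?thesis
    by (simp add: dpsi_def psi_eq_exp e exp_minus field_simps power2_eq_square)
qed

lemma dpsi_shift_le: "dpsi (t + x) \<le> exp \<bar>x\<bar> * dpsi t"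
proof -
  define A where "A = exp (t/2) + exp (-t/2)"
  define B where "B = exp ((t+x)/2) + exp (-(t+x)/2)"
  have pos: "A > 0" "B > 0" by (simp_all add: A_def B_def add_pos_pos)
  have "t / 2 \<le> \<bar>x\<bar>/2 + (t+x)/2" "-t / 2 \<le> \<bar>x\<bar>/2 + -(t+x)/2" by (simp_all add: field_simps)
  then have "A \<le> exp (\<bar>x\<bar>/2) * B"
    unfolding A_def B_def distrib_left by (intro add_mono) (simp_all only: exp_le_cancel_iff flip: exp_add)
  then have "A\<^sup>2 \<le> (exp (\<bar>x\<bar>/2) * B)\<^sup>2" using pos by (intro power_mono) auto
  also have "\<dots> = exp \<bar>x\<bar> * B\<^sup>2"
    by (simp add: power_mult_distrib power2_eq_square flip: exp_add)
  finally have "1 / B\<^sup>2 \<le> exp \<bar>x\<bar> * (1 / A\<^sup>2)" using pos by (simp add: field_simps)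
  then show ?thesis by (simp only: dpsi_eq A_def B_def)
qed

lemma dpsi_lower: "exp (- \<bar>t\<bar>) / 4 \<le> dpsi t"
proof -
  have "dpsi 0 \<le> exp \<bar>t\<bar> * dpsi t"
    using dpsi_shift_le[of t "- t"] by simp
  moreover have "dpsi 0 = 1 / 4" by (simp add: dpsi_def psi_def)
  ultimately show ?thesis by (simp add: exp_minus field_simps)
qed

text \<open>
  A relative bound rather than an absolute one: the curvature is controlled by the derivative
  itself, so that the nonlinearity can be compared with the weights of the Laplacian without
  losing a factor \<open>exp kappa_E\<close>.
\<close>
lemma dpsi_shift_diff:
  assumes "\<bar>x\<bar> \<le> 1"
  shows "\<bar>dpsi (t + x) - dpsi t\<bar> \<le> 2 * \<bar>x\<bar> * dpsi t"
proof -
  have e: "exp \<bar>x\<bar> \<le> 1 + 2 * \<bar>x\<bar>"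
  proof -
    have "exp \<bar>x\<bar> \<le> 1 + \<bar>x\<bar> + \<bar>x\<bar>\<^sup>2" using assms by (intro exp_bound) auto
    also have "\<bar>x\<bar>\<^sup>2 \<le> \<bar>x\<bar>" using assms by (simp only: power2_eq_square mult_left_le abs_ge_zero)
    finally show ?thesis by simp
  qed
  have up: "dpsi (t + x) \<le> (1 + 2 * \<bar>x\<bar>) * dpsi t"
    using dpsi_shift_le[of t x] mult_right_mono[OF e, of "dpsi t"] dpsi_pos[of t] by linarith
  have "dpsi t \<le> exp \<bar>x\<bar> * dpsi (t + x)" using dpsi_shift_le[of "t + x" "- x"] by simp
  then have "exp (- \<bar>x\<bar>) * dpsi t \<le> dpsi (t + x)" by (simp add: exp_minus field_simps)
  moreover have "1 - \<bar>x\<bar> \<le> exp (- \<bar>x\<bar>)" using exp_ge_add_one_self[of "- \<bar>x\<bar>"] by simp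
  then have "(1 - \<bar>x\<bar>) * dpsi t \<le> exp (- \<bar>x\<bar>) * dpsi t" using dpsi_pos[of t] by simp
  moreover have "0 \<le> \<bar>x\<bar> * dpsi t" using dpsi_pos[of t] by simp
  ultimately show ?thesis using up by (simp add: algebra_simps abs_le_iff)
qed

definition psi_rem :: "real \<Rightarrow> real \<Rightarrow> real" where
  "psi_rem t x = psi (t + x) - psi t - dpsi t * x"

lemma psi_rem_0 [simp]: "psi_rem t 0 = 0"
  by (simp add: psi_rem_def)

text \<open>
  The derivative of the remainder vanishes at zero, hence it is small near zero compared with
  \<open>dpsi t\<close>.  This makes the score equation a small perturbation of a linear one.
\<close>
lemma psi_rem_lipschitz:
  assumes "\<bar>x\<bar> \<le> m" "\<bar>y\<bar> \<le> m" "m \<le> 1"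
  shows "\<bar>psi_rem t x - psi_rem t y\<bar> \<le> 2 * m * dpsi t * \<bar>x - y\<bar>"
proof -
  have *: "\<bar>psi_rem t x - psi_rem t y\<bar> \<le> 2 * m * dpsi t * \<bar>x - y\<bar>"
    if "x < y" "\<bar>x\<bar> \<le> m" "\<bar>y\<bar> \<le> m" for x y
  proof -
    have "((psi_rem t) has_real_derivative dpsi (t + z) - dpsi t) (at z)" for z
      unfolding psi_rem_def[abs_def]
      by (auto intro!: derivative_eq_intros DERIV_chain2[OF psi_has_derivative])
    from MVT2[OF \<open>x < y\<close> this] obtain z where z: "x < z" "z < y"
      "psi_rem t y - psi_rem t x = (y - x) * (dpsi (t + z) - dpsi t)" by blast
    have zm: "\<bar>z\<bar> \<le> m" using z that by linarith
    have "\<bar>dpsi (t + z) - dpsi t\<bar> \<le> 2 * \<bar>z\<bar> * dpsi t"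
      using zm assms by (intro dpsi_shift_diff) simp
    also have "\<dots> \<le> 2 * m * dpsi t"
      using zm dpsi_pos[of t] by (intro mult_right_mono) auto
    finally have "\<bar>y - x\<bar> * \<bar>dpsi (t + z) - dpsi t\<bar> \<le> \<bar>y - x\<bar> * (2 * m * dpsi t)"
      by (intro mult_left_mono) auto
    then show ?thesis using z(3) by (simp add: abs_minus_commute[of "psi_rem t x"] abs_minus_commute[of x] abs_mult mult_ac)
  qed
  consider "x < y" | "x = y" | "y < x" by linarith
  then show ?thesis
    by cases (use *[of x y] *[of y x] assms in \<open>simp_all add: abs_minus_commute\<close>)
qed

definition edge_loss :: "real \<Rightarrow> real \<Rightarrow> real" where
  "edge_loss a t = - (a * ln (psi t) + (1 - a) * ln (1 - psi t))"

text \<open>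
  The loss is the convex function \<open>ln (1 + exp t)\<close> up to a linear term that carries the data.
\<close>
lemma edge_loss_eq: "edge_loss a t = ln (1 + exp t) - a * t"
proof -
  have p: "1 + exp t > 0" by (rule one_plus_exp_pos)
  have "1 - psi t = 1 / (1 + exp t)" by (simp add: psi_eq_exp field_simps)
  then have l1: "ln (1 - psi t) = - ln (1 + exp t)" using p by (simp add: ln_div)
  have l2: "ln (psi t) = t - ln (1 + exp t)" using p by (simp add: psi_eq_exp ln_div)
  show ?thesis unfolding edge_loss_def l1 l2 by (simp add: algebra_simps)
qed

lemma edge_loss_strict_tangent:
  assumes "t \<noteq> s"
  shows "edge_loss a s + (psi s - a) * (t - s) < edge_loss a t"
proof -
  define f where "f = (\<lambda>u. ln (1 + exp u) - psi s * u)"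
  have d: "(f has_real_derivative psi u - psi s) (at u)" for u
  proof -
    show ?thesis unfolding f_def using one_plus_exp_pos[of u] by (auto intro!: derivative_eq_intros simp: psi_eq_exp)
  qed
  have mono: "psi u < psi v" if "u < v" for u v
    using that DERIV_pos_imp_increasing[of u v psi] psi_has_derivative dpsi_pos by blast
  have "f s < f t"
  proof (cases "s < t")
    case True
    from MVT2[OF this d] obtain z where "s < z" "f t - f s = (t - s) * (psi z - psi s)" by blast
    moreover from this have "0 < (t - s) * (psi z - psi s)" using mono True by (intro mult_pos_pos) auto
    ultimately show ?thesis by linarith
  next
    case False
    with assms have "t < s" by simp
    from MVT2[OF this d] obtain z where "z < s" "f s - f t = (s - t) * (psi z - psi s)" by blast
    moreover from this have "(s - t) * (psi z - psi s) < 0"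
      using mono \<open>t < s\<close> by (intro mult_pos_neg) auto
    ultimately show ?thesis by linarith
  qed
  then show ?thesis by (simp add: edge_loss_eq f_def algebra_simps)
qed

section \<open>Flows and potentials on a weighted graph\<close>

text \<open>
  Each edge is listed once, as a pair \<open>(i, j)\<close> with \<open>i < j\<close>, so a function on the edge set is a flow:
  its sign refers to this orientation.  The gradient of the indicator \<open>unit i\<close> is the incidence
  vector of the vertex \<open>i\<close>, which makes \<open>divg\<close> the adjoint of \<open>grad\<close>.
\<close>
definition unit :: "nat \<Rightarrow> nat \<Rightarrow> real" where
  "unit i = (\<lambda>j. of_bool (j = i))"

definition grad :: "(nat \<Rightarrow> real) \<Rightarrow> nat \<times> nat \<Rightarrow> real" where
  "grad x = (\<lambda>(i, j). x i - x j)"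

definition divg :: "(nat \<times> nat) set \<Rightarrow> (nat \<times> nat \<Rightarrow> real) \<Rightarrow> nat \<Rightarrow> real" where
  "divg P f i = (\<Sum>e\<in>P. f e * grad (unit i) e)"

definition energy :: "(nat \<times> nat) set \<Rightarrow> (nat \<times> nat \<Rightarrow> real) \<Rightarrow> (nat \<Rightarrow> real) \<Rightarrow> real" where
  "energy P w x = (\<Sum>e\<in>P. w e * (grad x e)\<^sup>2)"

definition lap :: "(nat \<times> nat) set \<Rightarrow> (nat \<times> nat \<Rightarrow> real) \<Rightarrow> (nat \<Rightarrow> real) \<Rightarrow> nat \<Rightarrow> real" where
  "lap P w x = divg P (\<lambda>e. w e * grad x e)"

lemma grad_diff: "grad (\<lambda>i. x i - y i) e = grad x e - grad y e"
  by (simp add: grad_def split: prod.splits)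

lemma grad_const [simp]: "grad (\<lambda>_. c) e = 0"
  by (simp add: grad_def split: prod.splits)

lemma divg_diff: "divg P (\<lambda>e. f e - g e) i = divg P f i - divg P g i"
  by (simp add: divg_def sum_subtractf left_diff_distrib)

lemma lap_diff: "lap P w (\<lambda>i. x i - y i) i = lap P w x i - lap P w y i"
  by (simp add: lap_def grad_diff right_diff_distrib divg_diff)

lemma sum_unit:
  assumes "i < n"
  shows "(\<Sum>j<n. unit i j * x j) = x i" "(\<Sum>j<n. x j * unit j i) = x i"
proof -
  have "(\<Sum>j<n. unit i j * x j) = (\<Sum>j<n. if j = i then x j else 0)"
       "(\<Sum>j<n. x j * unit j i) = (\<Sum>j<n. if j = i then x j else 0)"
    by (auto simp: unit_def intro!: sum.cong)
  then show "(\<Sum>j<n. unit i j * x j) = x i" "(\<Sum>j<n. x j * unit j i) = x i"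
    using assms by simp_all
qed

lemma grad_sum_unit:
  assumes "P \<subseteq> {..<n} \<times> {..<n}" "e \<in> P"
  shows "(\<Sum>i<n. x i * grad (unit i) e) = grad x e"
proof -
  obtain j k where e: "e = (j, k)" and jk: "j < n" "k < n" using assms by auto
  have "(\<Sum>i<n. x i * grad (unit i) e) = (\<Sum>i<n. x i * unit i j) - (\<Sum>i<n. x i * unit i k)"
    by (simp add: e grad_def right_diff_distrib sum_subtractf)
  then show ?thesis using jk by (simp add: e grad_def sum_unit)
qed

lemma sum_divg:
  assumes "P \<subseteq> {..<n} \<times> {..<n}"
  shows "(\<Sum>i<n. x i * divg P f i) = (\<Sum>e\<in>P. f e * grad x e)"
proof -
  have "(\<Sum>i<n. x i * divg P f i) = (\<Sum>i<n. \<Sum>e\<in>P. f e * (x i * grad (unit i) e))"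
    by (simp add: divg_def sum_distrib_left mult.left_commute)
  also have "\<dots> = (\<Sum>e\<in>P. f e * (\<Sum>i<n. x i * grad (unit i) e))"
    by (subst sum.swap) (simp add: sum_distrib_left)
  finally show ?thesis using grad_sum_unit[OF assms] by simp
qed

text \<open>
  The Cauchy--Schwarz inequality for the inner product with weights \<open>w\<close>.  The Taylor remainder is
  dominated edge by edge by a gradient, so this is how it is measured in the energy norm.
\<close>
lemma flow_cauchy_schwarz:
  assumes w: "\<And>e. e \<in> P \<Longrightarrow> 0 \<le> w e" and c: "0 \<le> c"
    and f: "\<And>e. e \<in> P \<Longrightarrow> \<bar>f e\<bar> \<le> c * w e * \<bar>grad y e\<bar>"
  shows "\<bar>\<Sum>e\<in>P. f e * grad x e\<bar> \<le> c * sqrt (energy P w x) * sqrt (energy P w y)"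
proof -
  have L: "L2_set (\<lambda>e. sqrt (w e) * grad z e) P = sqrt (energy P w z)" for z
    unfolding L2_set_def energy_def using w by (simp add: power_mult_distrib)
  have "\<bar>\<Sum>e\<in>P. f e * grad x e\<bar> \<le> (\<Sum>e\<in>P. \<bar>f e\<bar> * \<bar>grad x e\<bar>)"
    by (rule order_trans[OF sum_abs]) (simp add: abs_mult)
  also have "\<dots> \<le> (\<Sum>e\<in>P. c * w e * \<bar>grad y e\<bar> * \<bar>grad x e\<bar>)"
    by (intro sum_mono mult_right_mono f) auto
  also have "\<dots> = c * (\<Sum>e\<in>P. \<bar>sqrt (w e) * grad x e\<bar> * \<bar>sqrt (w e) * grad y e\<bar>)"
    unfolding sum_distrib_left using w by (intro sum.cong) (auto simp: abs_mult)
  also have "\<dots> \<le> c * (L2_set (\<lambda>e. sqrt (w e) * grad x e) P * L2_set (\<lambda>e. sqrt (w e) * grad y e) P)"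
    by (intro mult_left_mono L2_set_mult_ineq c)
  finally show ?thesis by (simp add: L mult_ac)
qed

text \<open>
  A weighted graph with a spectral gap \<open>\<mu>\<close>, the gap being stated as a Poincare inequality.
\<close>
locale network =
  fixes n :: nat and P :: "(nat \<times> nat) set" and w :: "nat \<times> nat \<Rightarrow> real" and \<mu> :: real
  assumes n_pos: "0 < n"
    and P_sub: "P \<subseteq> {(i, j). i < j \<and> j < n}"
    and w_pos: "\<And>e. e \<in> P \<Longrightarrow> 0 < w e"
    and \<mu>_pos: "0 < \<mu>"
    and poincare: "\<And>x. (\<Sum>i<n. x i) = 0 \<Longrightarrow> \<mu> * (\<Sum>i<n. (x i)\<^sup>2) \<le> energy P w x"
begin

abbreviation "H \<equiv> lap P w"
abbreviation "\<E> \<equiv> energy P w"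
abbreviation "N x \<equiv> sqrt (energy P w x)"

lemma P_sub': "P \<subseteq> {..<n} \<times> {..<n}"
  using P_sub by auto

lemma finite_P: "finite P"
  using P_sub' by (rule finite_subset) simp

lemma energy_nonneg: "0 \<le> \<E> x"
  unfolding energy_def by (intro sum_nonneg mult_nonneg_nonneg) (auto dest: w_pos)

lemma sum_lap: "(\<Sum>i<n. y i * H x i) = (\<Sum>e\<in>P. w e * grad x e * grad y e)"
  unfolding lap_def by (rule sum_divg[OF P_sub'])

lemma energy_eq: "\<E> x = (\<Sum>i<n. x i * H x i)"
  by (simp add: sum_lap energy_def power2_eq_square mult.assoc)

lemma lap_symmetric: "(\<Sum>i<n. y i * H x i) = (\<Sum>i<n. x i * H y i)"
  by (simp add: sum_lap mult_ac)

lemma norm_le_energy: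
  assumes "(\<Sum>i<n. x i) = 0"
  shows "L2_set x {..<n} \<le> N x / sqrt \<mu>"
proof -
  have "L2_set x {..<n} \<le> sqrt (\<E> x / \<mu>)"
    unfolding L2_set_def using poincare[OF assms] \<mu>_pos
    by (intro real_sqrt_le_mono) (simp add: field_simps)
  then show ?thesis by (simp add: real_sqrt_divide)
qed

text \<open>
  \<open>H\<close> itself is singular on constants.  Adding the all-ones matrix makes it positive definite,
  hence invertible, and a solution of the modified system with centred right-hand side is
  centred, because the entries of \<open>H x\<close> sum to zero.
\<close>
lemma poisson_solvable:
  assumes b: "(\<Sum>i<n. b i) = 0"
  shows "\<exists>x. (\<Sum>i<n. x i) = 0 \<and> (\<forall>i<n. H x i = b i)"
proof -
  define M where "M = Matrix.mat n n (\<lambda>(i, j). H (unit j) i + 1)"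
  have MC: "M \<in> carrier_mat n n" by (simp add: M_def)
  have M: "(M *\<^sub>v v) $ i = H (\<lambda>j. v $ j) i + (\<Sum>j<n. v $ j)"
    if "i < n" "v \<in> carrier_vec n" for i v
  proof -
    have "H (\<lambda>j. v $ j) i = (\<Sum>e\<in>P. w e * (\<Sum>j<n. v $ j * grad (unit j) e) * grad (unit i) e)"
      unfolding lap_def divg_def
      by (intro sum.cong refl) (use grad_sum_unit[OF P_sub'] in simp)
    also have "\<dots> = (\<Sum>j<n. v $ j * H (unit j) i)"
      unfolding lap_def divg_def sum_distrib_left sum_distrib_right
      by (subst sum.swap) (simp add: mult_ac)
    finally show ?thesis using that
      by (simp add: M_def scalar_prod_def atLeast0LessThan algebra_simps sum.distrib)
  qed
  have "det M \<noteq> 0"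
  proof
    assume "det M = 0"
    then obtain v where v: "v \<in> carrier_vec n" "v \<noteq> 0\<^sub>v n" "M *\<^sub>v v = 0\<^sub>v n"
      using det_0_iff_vec_prod_zero_field[OF MC] by blast
    define x where "x = (\<lambda>j. v $ j)"
    define S where "S = (\<Sum>j<n. x j)"
    have "H x i + S = 0" if "i < n" for i
      using M[OF that v(1)] v(3) that by (simp add: x_def S_def)
    then have "(\<Sum>i<n. x i * (H x i + S)) = 0" by simp
    then have "\<E> x + S * S = 0"
      by (simp add: energy_eq distrib_left sum.distrib S_def sum_distrib_right)
    then have 0: "S = 0" "\<E> x = 0"
      using energy_nonneg[of x] zero_le_square[of S]
      by (auto simp: add_nonneg_eq_0_iff)
    then have "\<mu> * (\<Sum>i<n. (x i)\<^sup>2) \<le> 0" using poincare[of x] by (simp add: S_def)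
    moreover have nn: "0 \<le> (\<Sum>i<n. (x i)\<^sup>2)" by (intro sum_nonneg) auto
    ultimately have "(\<Sum>i<n. (x i)\<^sup>2) = 0" using \<mu>_pos by (simp add: mult_le_0_iff)
    then have "x i = 0" if "i < n" for i
      using that by (subst (asm) sum_nonneg_eq_0_iff) auto
    then have "v = 0\<^sub>v n" using v(1) by (intro eq_vecI) (auto simp: x_def)
    with v(2) show False by simp
  qed
  from det_non_zero_imp_unit[OF MC this, of "()"]
  obtain B where B: "B \<in> carrier_mat n n" "M * B = 1\<^sub>m n"
    unfolding Units_def ring_mat_def by auto
  define v where "v = B *\<^sub>v Matrix.vec n b"
  define x where "x = (\<lambda>j. v $ j)"
  have v: "v \<in> carrier_vec n" using B by (simp add: v_def)
  have "M *\<^sub>v v = (M * B) *\<^sub>v Matrix.vec n b"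
    unfolding v_def by (rule assoc_mult_mat_vec[symmetric, OF MC B(1)]) simp
  then have Mv: "M *\<^sub>v v = Matrix.vec n b" using B by simp
  have eq: "H x i + (\<Sum>j<n. x j) = b i" if "i < n" for i
    using M[OF that v] that by (simp add: x_def Mv)
  have "(\<Sum>i<n. H x i) = 0"
    using sum_lap[of "\<lambda>_. 1" x] by simp
  moreover have "(\<Sum>i<n. H x i + (\<Sum>j<n. x j)) = 0" using eq b by simp
  ultimately have "(\<Sum>j<n. x j) = 0" using n_pos by (simp add: sum.distrib)
  with eq show ?thesis by (intro exI[of _ x]) auto
qed

lemma poisson_divg_solvable: "\<exists>x. (\<Sum>i<n. x i) = 0 \<and> (\<forall>i<n. H x i = divg P f i)"
  using sum_divg[OF P_sub', of "\<lambda>_. 1" f] by (intro poisson_solvable) simp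

lemma energy_of_solution:
  assumes "\<And>i. i < n \<Longrightarrow> H x i = divg P f i"
  shows "\<E> x = (\<Sum>e\<in>P. f e * grad x e)"
  using assms by (simp add: energy_eq sum_divg[OF P_sub'])

lemma norm_of_solution_le:
  assumes "\<E> x \<le> c * N x" "0 \<le> c"
  shows "N x \<le> c"
proof (cases "\<E> x = 0")
  case False
  then have "0 < N x" using energy_nonneg[of x] by simp
  moreover have "\<E> x = N x * N x" using energy_nonneg[of x] by simp
  ultimately show ?thesis using assms(1) by (metis mult_le_cancel_right_pos)
qed (use assms in simp)

text \<open>
  Picard iteration from zero.  Testing the equation with its own solution shows that the energy
  norm of an iterate is at most \<open>R\<close> plus half the norm of the previous one, and that
  differences of iterates are halved.  Neither bound controls the supremum norm, on which the
  Lipschitz condition depends, so its invariance is the hypothesis \<open>sup\<close>.  By the Poincare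
  inequality convergence in energy gives convergence of each coordinate.
\<close>
lemma nonlinear_poisson_solvable:
  fixes f :: "nat \<times> nat \<Rightarrow> real \<Rightarrow> real" and \<beta> :: "nat \<times> nat \<Rightarrow> real"
  assumes lip: "\<And>e x y. e \<in> P \<Longrightarrow> \<bar>x\<bar> \<le> 2 * \<rho> \<Longrightarrow> \<bar>y\<bar> \<le> 2 * \<rho> \<Longrightarrow>
                  \<bar>f e x - f e y\<bar> \<le> 1/2 * w e * \<bar>x - y\<bar>"
    and f0: "\<And>e. f e 0 = 0"
    and cont: "\<And>e. e \<in> P \<Longrightarrow> continuous_on UNIV (f e)"
    and R: "0 \<le> R" "\<And>x. (\<Sum>i<n. x i) = 0 \<Longrightarrow> \<bar>\<Sum>e\<in>P. \<beta> e * grad x e\<bar> \<le> R * N x"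
    and \<rho>: "0 \<le> \<rho>"
    and sup: "\<And>x d i. (\<Sum>i<n. x i) = 0 \<Longrightarrow> \<forall>i<n. \<bar>d i\<bar> \<le> \<rho> \<Longrightarrow> N d \<le> 2 * R \<Longrightarrow>
                \<forall>i<n. H x i = divg P (\<lambda>e. \<beta> e - f e (grad d e)) i \<Longrightarrow> i < n \<Longrightarrow> \<bar>x i\<bar> \<le> \<rho>"
  shows "\<exists>d. (\<Sum>i<n. d i) = 0 \<and> (\<forall>i<n. \<bar>d i\<bar> \<le> \<rho>) \<and> N d \<le> 2 * R \<and>
             (\<forall>i<n. H d i = divg P (\<lambda>e. \<beta> e - f e (grad d e)) i)"
proof -
  define F where "F = (\<lambda>d e. \<beta> e - f e (grad d e))"
  have "\<forall>d. \<exists>x. (\<Sum>i<n. x i) = 0 \<and> (\<forall>i<n. H x i = divg P (F d) i)"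
    by (intro allI poisson_divg_solvable)
  from choice[OF this] obtain T where T0: "\<And>d. (\<Sum>i<n. T d i) = 0"
    and T: "\<And>d i. i < n \<Longrightarrow> H (T d) i = divg P (F d) i" by auto
  define K where "K = {d. (\<Sum>i<n. d i) = 0 \<and> (\<forall>i<n. \<bar>d i\<bar> \<le> \<rho>) \<and> N d \<le> 2 * R}"
  \<comment> \<open>on \<open>K\<close> all gradients lie in the range of the Lipschitz condition\<close>
  have g: "\<bar>grad d e\<bar> \<le> 2 * \<rho>" if d: "d \<in> K" and eP: "e \<in> P" for d e
  proof -
    obtain j k where e: "e = (j, k)" "j < n" "k < n" using eP P_sub' by auto
    then have "\<bar>d j\<bar> \<le> \<rho>" "\<bar>d k\<bar> \<le> \<rho>" using d by (auto simp: K_def)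
    then show ?thesis by (simp add: e grad_def)
  qed
  have TK: "T d \<in> K" if d: "d \<in> K" for d
  proof -
    have f1: "\<bar>\<Sum>e\<in>P. f e (grad d e) * grad (T d) e\<bar> \<le> 1/2 * N (T d) * N d"
    proof (rule flow_cauchy_schwarz)
      show "\<bar>f e (grad d e)\<bar> \<le> 1/2 * w e * \<bar>grad d e\<bar>" if "e \<in> P" for e
        using lip[OF that g[OF d that], of 0] \<rho> f0 by simp
    qed (use w_pos in \<open>auto intro: less_imp_le\<close>)
    have f2: "\<bar>\<Sum>e\<in>P. \<beta> e * grad (T d) e\<bar> \<le> R * N (T d)" by (rule R(2)[OF T0])
    have f3: "\<E> (T d) = (\<Sum>e\<in>P. \<beta> e * grad (T d) e) - (\<Sum>e\<in>P. f e (grad d e) * grad (T d) e)"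
      using energy_of_solution[OF T] by (simp add: F_def left_diff_distrib sum_subtractf)
    have "\<E> (T d) \<le> R * N (T d) + 1/2 * N (T d) * N d" using f1 f2 f3 by linarith
    also have "\<dots> = (R + 1/2 * N d) * N (T d)" by (simp add: algebra_simps)
    finally have "N (T d) \<le> R + 1/2 * N d"
      by (rule norm_of_solution_le) (use R(1) energy_nonneg[of d] in simp)
    then have "N (T d) \<le> 2 * R" using d by (simp add: K_def)
    moreover have "\<bar>T d i\<bar> \<le> \<rho>" if "i < n" for i
      using sup[OF T0, of d d i] d that T by (auto simp: K_def F_def)
    ultimately show ?thesis using T0 by (simp add: K_def)
  qed
  have contr: "N (\<lambda>i. T d i - T d' i) \<le> 1/2 * N (\<lambda>i. d i - d' i)" if d: "d \<in> K" "d' \<in> K" for d d'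
  proof (rule norm_of_solution_le)
    have "\<E> (\<lambda>i. T d i - T d' i) = (\<Sum>e\<in>P. (F d e - F d' e) * grad (\<lambda>i. T d i - T d' i) e)"
      by (rule energy_of_solution) (simp add: lap_diff T divg_diff)
    also have "\<dots> \<le> 1/2 * N (\<lambda>i. T d i - T d' i) * N (\<lambda>i. d i - d' i)"
    proof (rule order_trans[OF abs_ge_self flow_cauchy_schwarz])
      show "\<bar>F d e - F d' e\<bar> \<le> 1/2 * w e * \<bar>grad (\<lambda>i. d i - d' i) e\<bar>" if "e \<in> P" for e
        using lip[OF that g[OF d(2) that] g[OF d(1) that]]
        by (simp add: F_def grad_diff abs_minus_commute)
    qed (use w_pos in \<open>auto intro: less_imp_le\<close>)
    finally show "\<E> (\<lambda>i. T d i - T d' i) \<le> 1/2 * N (\<lambda>i. d i - d' i) * N (\<lambda>i. T d i - T d' i)"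
      by (simp add: mult_ac)
  qed (use energy_nonneg in auto)
  define d where "d = (\<lambda>k. (T ^^ k) (\<lambda>_. 0))"
  have d_Suc: "d (Suc k) = T (d k)" for k by (simp add: d_def)
  have dK: "d k \<in> K" for k
  proof (induction k)
    case 0
    show ?case using \<rho> R(1) by (simp add: d_def K_def energy_def)
  qed (simp add: d_Suc TK)
  define D where "D k = (\<lambda>i. d (Suc k) i - d k i)" for k
  have DN: "N (D k) \<le> (1/2) ^ k * N (D 0)" for k
  proof (induction k)
    case (Suc k)
    have "N (D (Suc k)) \<le> 1/2 * N (D k)"
      using contr[OF dK dK, of "Suc k" k] by (simp add: D_def d_Suc)
    then show ?case using Suc by simp
  qed simp
  have "convergent (\<lambda>k. d k i)" if i: "i < n" for i
  proof -
    have "\<bar>D k i\<bar> \<le> (1/2) ^ k * (N (D 0) / sqrt \<mu>)" for k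
    proof -
      have "\<bar>D k i\<bar> = L2_set (D k) {i}" by (simp add: L2_set_def)
      also have "\<dots> \<le> L2_set (D k) {..<n}"
        unfolding L2_set_def using i by (intro real_sqrt_le_mono sum_mono2) auto
      also have "(\<Sum>i<n. D k i) = 0"
        using dK[of k] dK[of "Suc k"] by (simp add: K_def D_def sum_subtractf)
      then have "L2_set (D k) {..<n} \<le> N (D k) / sqrt \<mu>" by (rule norm_le_energy)
      also have "\<dots> \<le> ((1/2) ^ k * N (D 0)) / sqrt \<mu>"
        using DN \<mu>_pos by (intro divide_right_mono) auto
      finally show ?thesis by simp
    qed
    moreover have "summable (\<lambda>k. (1/2::real) ^ k * (N (D 0) / sqrt \<mu>))"
      by (intro summable_mult2 summable_geometric) simp
    ultimately have "summable (\<lambda>k. D k i)"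
      using summable_comparison_test'[of "\<lambda>k. (1/2) ^ k * (N (D 0) / sqrt \<mu>)" 0 "\<lambda>k. D k i"]
      by (simp only: real_norm_def)
    then have "(\<lambda>m. (\<Sum>k<m. D k i) + d 0 i) \<longlonglongrightarrow> suminf (\<lambda>k. D k i) + d 0 i"
      by (intro tendsto_add summable_LIMSEQ tendsto_const)
    moreover have "(\<Sum>k<m. D k i) + d 0 i = d m i" for m
      unfolding D_def by (induction m) simp_all
    ultimately show ?thesis by (auto simp: convergent_def)
  qed
  then obtain y where y: "\<And>i. i < n \<Longrightarrow> (\<lambda>k. d k i) \<longlonglongrightarrow> y i"
    unfolding convergent_def by metis
  have gy: "(\<lambda>k. grad (d k) e) \<longlonglongrightarrow> grad y e" if eP: "e \<in> P" for e
  proof -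
    obtain j k where e: "e = (j, k)" "j < n" "k < n" using eP P_sub' by auto
    then show ?thesis by (simp add: grad_def tendsto_diff y)
  qed
  have fy: "(\<lambda>k. f e (grad (d k) e)) \<longlonglongrightarrow> f e (grad y e)" if "e \<in> P" for e
    using continuous_on_tendsto_compose[OF cont[OF that] gy[OF that]] by simp
  have "(\<Sum>i<n. y i) = 0"
  proof (rule LIMSEQ_unique)
    show "(\<lambda>k. \<Sum>i<n. d k i) \<longlonglongrightarrow> (\<Sum>i<n. y i)" by (intro tendsto_sum y) auto
    show "(\<lambda>k. \<Sum>i<n. d k i) \<longlonglongrightarrow> 0" using dK by (simp add: K_def)
  qed
  moreover have "\<bar>y i\<bar> \<le> \<rho>" if "i < n" for i
    by (rule LIMSEQ_le_const2[OF tendsto_rabs[OF y[OF that]]]) (use dK that in \<open>auto simp: K_def\<close>)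
  moreover have "N y \<le> 2 * R"
  proof (rule LIMSEQ_le_const2)
    show "(\<lambda>k. N (d k)) \<longlonglongrightarrow> N y"
      unfolding energy_def by (intro tendsto_intros gy)
  qed (use dK in \<open>auto simp: K_def\<close>)
  moreover have "H y i = divg P (F y) i" if i: "i < n" for i
  proof (rule LIMSEQ_unique)
    show "(\<lambda>k. H (d (Suc k)) i) \<longlonglongrightarrow> H y i"
      unfolding lap_def divg_def by (intro tendsto_intros LIMSEQ_Suc[OF gy])
    have "(\<lambda>k. divg P (F (d k)) i) \<longlonglongrightarrow> divg P (F y) i"
      unfolding divg_def F_def by (intro tendsto_intros fy)
    then show "(\<lambda>k. H (d (Suc k)) i) \<longlonglongrightarrow> divg P (F y) i"
      by (simp add: d_Suc T[OF i])
  qed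
  ultimately show ?thesis by (intro exI[of _ y]) (auto simp: F_def)
qed

text \<open>
  Row \<open>i\<close> of \<open>H x\<close> says that \<open>x i\<close> is \<open>H x i / D\<close> plus the average \<open>u \<bullet> x\<close> of \<open>x\<close> over the neighbours of
  \<open>i\<close> with weights \<open>u j = w (i, j) / D\<close>.  The average is \<open>q \<bullet> H x\<close> for the potential \<open>q\<close> with
  \<open>H q = u - 1 / n\<close>.  Averaging makes \<open>u\<close> short, \<open>u \<bullet> u \<le> W / D\<close>, and therefore \<open>q\<close> of small
  energy, whereas for a potential of \<open>unit i\<close> itself the same argument gives only the energy bound \<open>1 / \<mu>\<close>.
\<close>
lemma pointwise_test_vector:
  assumes i: "i < n" and W: "0 \<le> W" "\<And>e. e \<in> P \<Longrightarrow> w e \<le> W" and D: "0 < \<E> (unit i)"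
  shows "\<exists>q. \<E> q \<le> W / (\<mu> * \<E> (unit i)) \<and>
    (\<forall>x. (\<Sum>j<n. x j) = 0 \<longrightarrow> x i = H x i / \<E> (unit i) + (\<Sum>j<n. q j * H x j))"
proof -
  define D where "D = \<E> (unit i)"
  have Dpos: "0 < D" using D by (simp add: D_def)
  define u where "u = (\<lambda>j. unit i j - H (unit i) j / D)"
  have "(\<Sum>j<n. u j) = 1"
    using sum_lap[of "\<lambda>_. 1" "unit i"] sum_unit(1)[OF i, of "\<lambda>_. 1"]
    by (simp add: u_def sum_subtractf flip: sum_divide_distrib)
  then obtain q where q0: "(\<Sum>j<n. q j) = 0" and q: "\<And>j. j < n \<Longrightarrow> H q j = u j - 1 / n"
    using poisson_solvable[of "\<lambda>j. u j - 1 / n"] n_pos by (auto simp: sum_subtractf)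
  have Hq: "(\<Sum>j<n. x j * H q j) = (\<Sum>j<n. x j * u j)" if "(\<Sum>j<n. x j) = 0" for x
    using that by (simp add: q right_diff_distrib sum_subtractf flip: sum_divide_distrib)
  have xu: "(\<Sum>j<n. x j * u j) = x i - H x i / D" for x
  proof -
    have "(\<Sum>j<n. x j * H (unit i) j) = H x i"
      using lap_symmetric[of x "unit i"] sum_unit(1)[OF i] by simp
    moreover have "(\<Sum>j<n. x j * unit i j) = x i"
      using sum_unit(1)[OF i, of x] by (simp add: mult.commute)
    ultimately show ?thesis
      by (simp add: u_def right_diff_distrib sum_subtractf flip: sum_divide_distrib)
  qed
  have repr: "x i = H x i / D + (\<Sum>j<n. q j * H x j)" if "(\<Sum>j<n. x j) = 0" for x
    using Hq[OF that] xu[of x] lap_symmetric[of q x] by simp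
  \<comment> \<open>the sum of \<open>q j * u j\<close> is rewritten over the edges at \<open>i\<close>, each of which contributes the value of \<open>q\<close>
    at its other endpoint \<open>oth e\<close>\<close>
  define A where "A = {e \<in> P. fst e = i \<or> snd e = i}"
  define oth where "oth = (\<lambda>e. if fst e = i then snd e else fst e)"
  have "D * (\<Sum>j<n. q j * u j) = D * q i - H q i"
    using Dpos by (simp add: xu field_simps)
  also have "\<dots> = (\<Sum>e\<in>P. w e * ((grad (unit i) e)\<^sup>2 * q i - grad q e * grad (unit i) e))"
    unfolding D_def energy_def lap_def divg_def
    by (simp add: sum_distrib_right right_diff_distrib sum_subtractf mult.assoc)
  also have "\<dots> = (\<Sum>e\<in>P. w e * (of_bool (e \<in> A) * q (oth e)))"
  proof (intro sum.cong refl)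
    fix e assume "e \<in> P"
    moreover from this obtain j k where "e = (j, k)" "j < k" using P_sub by auto
    ultimately show "w e * ((grad (unit i) e)\<^sup>2 * q i - grad q e * grad (unit i) e)
        = w e * (of_bool (e \<in> A) * q (oth e))"
      by (auto simp: grad_def unit_def A_def oth_def)
  qed
  also have "\<dots> = (\<Sum>e\<in>A. w e * q (oth e))"
    by (rule sum.mono_neutral_cong_right) (auto simp: A_def finite_P)
  finally have Du: "D * (\<Sum>j<n. q j * u j) = (\<Sum>e\<in>A. w e * q (oth e))" .
  have DA: "D = (\<Sum>e\<in>A. w e)"
    unfolding D_def energy_def
  proof (rule sum.mono_neutral_cong_right)
    show "w e * (grad (unit i) e)\<^sup>2 = w e" if "e \<in> A" for e
      using that P_sub by (auto simp: A_def grad_def unit_def)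
  qed (auto simp: A_def finite_P grad_def unit_def)
  have inj: "inj_on oth A"
  proof (rule inj_onI)
    fix e e' assume "e \<in> A" "e' \<in> A" "oth e = oth e'"
    moreover obtain j k j' k' where "e = (j, k)" "e' = (j', k')" by (metis surj_pair)
    moreover from calculation have "j < k" "j' < k'" using P_sub by (auto simp: A_def)
    ultimately show "e = e'" by (auto simp: A_def oth_def split: if_splits)
  qed
  have "(\<Sum>e\<in>A. (q (oth e))\<^sup>2) = (\<Sum>j\<in>oth ` A. (q j)\<^sup>2)"
    using sum.reindex[OF inj, of "\<lambda>j. (q j)\<^sup>2"] by simp
  also have "\<dots> \<le> (\<Sum>j<n. (q j)\<^sup>2)"
    using P_sub by (intro sum_mono2) (auto simp: A_def oth_def)
  also have "\<dots> \<le> \<E> q / \<mu>" using poincare[OF q0] \<mu>_pos by (simp add: field_simps)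
  finally have q2: "(\<Sum>e\<in>A. (q (oth e))\<^sup>2) \<le> \<E> q / \<mu>" .
  have Eq: "\<E> q = (\<Sum>j<n. q j * u j)" using energy_eq[of q] Hq[OF q0] by simp
  have wA: "0 < w e" "w e \<le> W" if "e \<in> A" for e using that w_pos W by (auto simp: A_def)
  have "(D * \<E> q)\<^sup>2 = (\<Sum>e\<in>A. sqrt (w e) * (sqrt (w e) * q (oth e)))\<^sup>2"
    unfolding Eq Du using wA by (intro arg_cong[where f = "\<lambda>x. x\<^sup>2"] sum.cong) (auto simp: less_imp_le)
  also have "\<dots> \<le> (\<Sum>e\<in>A. (sqrt (w e))\<^sup>2) * (\<Sum>e\<in>A. (sqrt (w e) * q (oth e))\<^sup>2)"
    by (rule Cauchy_Schwarz_ineq_sum)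
  also have "(\<Sum>e\<in>A. (sqrt (w e))\<^sup>2) = D"
    unfolding DA using wA by (intro sum.cong) (auto simp: less_imp_le)
  also have "(\<Sum>e\<in>A. (sqrt (w e) * q (oth e))\<^sup>2) \<le> (\<Sum>e\<in>A. W * (q (oth e))\<^sup>2)"
    using wA by (intro sum_mono) (auto simp: power_mult_distrib less_imp_le intro!: mult_right_mono)
  also have "\<dots> \<le> W * (\<E> q / \<mu>)"
    unfolding sum_distrib_left[symmetric] by (intro mult_left_mono q2 W)
  finally have "(D * \<E> q)\<^sup>2 \<le> D * (W * (\<E> q / \<mu>))" using Dpos by simp
  then have *: "D * \<E> q * (D * \<E> q) \<le> (W / \<mu>) * (D * \<E> q)"
    by (simp add: power2_eq_square mult_ac)
  have "D * \<E> q \<le> W / \<mu>"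
  proof (cases "\<E> q = 0")
    case True
    then show ?thesis using W(1) \<mu>_pos by simp
  next
    case False
    then have "0 < D * \<E> q" using energy_nonneg[of q] Dpos by simp
    with * show ?thesis by (rule mult_right_le_imp_le)
  qed
  then have "\<E> q \<le> W / (\<mu> * D)" using Dpos \<mu>_pos by (simp add: field_simps)
  with repr show ?thesis unfolding D_def by blast
qed

end

section \<open>The second Laplacian eigenvalue\<close>

definition edges :: "nat \<Rightarrow> (nat \<times> nat) set \<Rightarrow> (nat \<times> nat) set" where
  "edges n E = {(i, j). i < j \<and> j < n \<and> (i, j) \<in> E}"

lemma edges_sub: "edges n E \<subseteq> {(i, j). i < j \<and> j < n}" "edges n E \<subseteq> {..<n} \<times> {..<n}"
  by (auto simp: edges_def)

lemma finite_edges: "finite (edges n E)"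
  by (rule finite_subset[OF edges_sub(2)]) simp

text \<open>
  Passage from the oriented edge list to the rows of the adjacency matrix.
\<close>
lemma sum_edges_unit:
  assumes "simple_graph n E" "i < n"
  shows "(\<Sum>e\<in>edges n E. g e * grad (unit i) e)
           = (\<Sum>j<n. adj E i j * (if i < j then g (i, j) else - g (j, i)))"
proof -
  have irr: "(i, i) \<notin> E" and sy: "(j, i) \<in> E \<longleftrightarrow> (i, j) \<in> E" for j
    using assms by (auto simp: simple_graph_def irrefl_def sym_def)
  define A where "A = {j. j < n \<and> (i, j) \<in> E \<and> i < j}"
  define B where "B = {j. j < n \<and> (i, j) \<in> E \<and> j < i}"
  have "(\<Sum>e\<in>edges n E. g e * grad (unit i) e)
      = (\<Sum>e\<in>Pair i ` A \<union> (\<lambda>j. (j, i)) ` B. g e * grad (unit i) e)"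
  proof (rule sum.mono_neutral_right[OF finite_edges])
    show "Pair i ` A \<union> (\<lambda>j. (j, i)) ` B \<subseteq> edges n E"
      using assms(2) sy by (auto simp: edges_def A_def B_def)
    show "\<forall>e\<in>edges n E - (Pair i ` A \<union> (\<lambda>j. (j, i)) ` B). g e * grad (unit i) e = 0"
    proof
      fix e assume e: "e \<in> edges n E - (Pair i ` A \<union> (\<lambda>j. (j, i)) ` B)"
      obtain a b where ab: "e = (a, b)" by (metis surj_pair)
      have "a \<noteq> i" using e ab by (auto simp: edges_def A_def)
      moreover have "b \<noteq> i" using e ab sy by (auto simp: edges_def B_def)
      ultimately show "g e * grad (unit i) e = 0" by (simp add: ab grad_def unit_def)
    qed
  qed
  also have "\<dots> = (\<Sum>e\<in>Pair i ` A. g e * grad (unit i) e) + (\<Sum>e\<in>(\<lambda>j. (j, i)) ` B. g e * grad (unit i) e)"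
    by (intro sum.union_disjoint) (auto simp: A_def B_def)
  also have "(\<Sum>e\<in>Pair i ` A. g e * grad (unit i) e) = (\<Sum>j\<in>A. g (i, j))"
    by (subst sum.reindex) (auto simp: inj_on_def A_def grad_def unit_def intro!: sum.cong)
  also have "(\<Sum>e\<in>(\<lambda>j. (j, i)) ` B. g e * grad (unit i) e) = (\<Sum>j\<in>B. - g (j, i))"
    by (subst sum.reindex) (auto simp: inj_on_def B_def grad_def unit_def intro!: sum.cong)
  also have "(\<Sum>j\<in>A. g (i, j)) + (\<Sum>j\<in>B. - g (j, i))
      = (\<Sum>j\<in>A \<union> B. if i < j then g (i, j) else - g (j, i))"
    by (subst sum.union_disjoint) (auto simp: A_def B_def intro!: arg_cong2[where f = "(+)"] sum.cong)
  also have "\<dots> = (\<Sum>j<n. adj E i j * (if i < j then g (i, j) else - g (j, i)))"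
  proof (rule sum.mono_neutral_cong_left)
    show "\<forall>j\<in>{..<n} - (A \<union> B). adj E i j * (if i < j then g (i, j) else - g (j, i)) = 0"
      using irr by (auto simp: A_def B_def adj_def) (metis linorder_neqE_nat)+
  qed (auto simp: A_def B_def adj_def)
  finally show ?thesis .
qed

lemma lap_unweighted:
  assumes "simple_graph n E" "i < n"
  shows "lap (edges n E) (\<lambda>_. 1) x i = degree_of n E i * x i - (\<Sum>j<n. adj E i j * x j)"
proof -
  have "lap (edges n E) (\<lambda>_. 1) x i = (\<Sum>j<n. adj E i j * (x i - x j))"
    unfolding lap_def divg_def sum_edges_unit[OF assms]
    by (intro sum.cong) (auto simp: grad_def)
  then show ?thesis
    by (simp add: right_diff_distrib sum_subtractf degree_of_def sum_distrib_right)
qed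

lemma degree_eq:
  assumes "simple_graph n E" "i < n"
  shows "(\<Sum>e\<in>edges n E. (grad (unit i) e)\<^sup>2) = degree_of n E i"
proof -
  have "(\<Sum>e\<in>edges n E. (grad (unit i) e)\<^sup>2) = lap (edges n E) (\<lambda>_. 1) (unit i) i"
    by (simp add: lap_def divg_def power2_eq_square)
  also have "\<dots> = degree_of n E i * unit i i - (\<Sum>j<n. adj E i j * unit i j)"
    by (rule lap_unweighted[OF assms])
  also have "(\<Sum>j<n. adj E i j * unit i j) = adj E i i"
    using sum_unit(1)[OF assms(2), of "adj E i"] by (simp add: mult.commute)
  also have "adj E i i = 0" using assms(1) by (simp add: adj_def simple_graph_def irrefl_def)
  finally show ?thesis by (simp add: unit_def)
qed

lemma degree_bounds:
  assumes "i < n"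
  shows "n_min n E \<le> degree_of n E i" "degree_of n E i \<le> n_max n E"
  using assms by (simp_all add: n_min_def n_max_def)

lemma energy_le_degree:
  assumes "simple_graph n E"
  shows "(\<Sum>e\<in>edges n E. (grad z e)\<^sup>2) \<le> 2 * n_max n E * (\<Sum>i<n. (z i)\<^sup>2)"
proof -
  have "(\<Sum>e\<in>edges n E. (grad z e)\<^sup>2) \<le> (\<Sum>e\<in>edges n E. 2 * (\<Sum>i<n. (z i)\<^sup>2 * (grad (unit i) e)\<^sup>2))"
  proof (rule sum_mono)
    fix e assume "e \<in> edges n E"
    then obtain j k where e: "e = (j, k)" "j < k" "k < n" by (auto simp: edges_def)
    have "(\<Sum>i<n. (z i)\<^sup>2 * (grad (unit i) e)\<^sup>2) = (\<Sum>i\<in>{j, k}. (z i)\<^sup>2 * (grad (unit i) e)\<^sup>2)"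
      using e by (intro sum.mono_neutral_right) (auto simp: grad_def unit_def)
    also have "\<dots> = (z j)\<^sup>2 + (z k)\<^sup>2" using e by (simp add: grad_def unit_def)
    finally have "(\<Sum>i<n. (z i)\<^sup>2 * (grad (unit i) e)\<^sup>2) = (z j)\<^sup>2 + (z k)\<^sup>2" .
    moreover have "(z j - z k)\<^sup>2 \<le> 2 * ((z j)\<^sup>2 + (z k)\<^sup>2)"
      using zero_le_power2[of "z j + z k"] by (simp add: power2_eq_square algebra_simps)
    ultimately show "(grad z e)\<^sup>2 \<le> 2 * (\<Sum>i<n. (z i)\<^sup>2 * (grad (unit i) e)\<^sup>2)"
      by (simp add: e grad_def)
  qed
  also have "\<dots> = 2 * (\<Sum>i<n. (z i)\<^sup>2 * degree_of n E i)"
    unfolding sum_distrib_left[symmetric]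
    by (subst sum.swap) (simp add: sum_distrib_left[symmetric] degree_eq[OF assms])
  also have "\<dots> \<le> 2 * (\<Sum>i<n. (z i)\<^sup>2 * n_max n E)"
    by (intro mult_left_mono sum_mono degree_bounds) auto
  also have "\<dots> = 2 * n_max n E * (\<Sum>i<n. (z i)\<^sup>2)" by (simp add: sum_distrib_left mult_ac)
  finally show ?thesis .
qed

lemma connected_degree_ge_1:
  assumes "simple_graph n E" "connected_graph n E" "2 \<le> n" "i < n"
  shows "1 \<le> degree_of n E i"
proof -
  obtain j where j: "j < n" "j \<noteq> i" using assms(3,4) that[of 0] that[of 1] by (cases "i = 0") auto
  then have "(i, j) \<in> E\<^sup>*" using assms by (auto simp: connected_graph_def)
  with j obtain k where k: "(i, k) \<in> E" by (metis converse_rtranclE)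
  then have kn: "k < n" using assms(1) by (auto simp: simple_graph_def)
  have "adj E i k \<le> (\<Sum>j<n. adj E i j)"
    using kn by (intro member_le_sum) (auto simp: adj_def)
  then show ?thesis using k by (simp add: degree_of_def adj_def)
qed

lemma connected_grad_0_imp_const:
  assumes "simple_graph n E" "connected_graph n E" "\<And>e. e \<in> edges n E \<Longrightarrow> grad x e = 0"
    "i < n" "j < n"
  shows "x i = x j"
proof -
  have "(i, j) \<in> E\<^sup>*" using assms by (auto simp: connected_graph_def)
  then show ?thesis
  proof (induction rule: rtrancl_induct)
    case (step b c)
    then have "b < n" "c < n" "b \<noteq> c" "(c, b) \<in> E"
      using assms(1) by (auto simp: simple_graph_def irrefl_def sym_def)
    then have "(b, c) \<in> edges n E \<or> (c, b) \<in> edges n E"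
      using step by (auto simp: edges_def)
    then have "x b = x c" using assms(3) by (force simp: grad_def)
    with step show ?case by simp
  qed simp
qed

text \<open>
  The sphere of centred unit vectors is compact as a closed subset of a product of intervals;
  outside \<open>{..<n}\<close> the coordinates are set to zero for this purpose.
\<close>
lemma energy_minimizer:
  assumes n: "2 \<le> n" and P: "P \<subseteq> {..<n} \<times> {..<n}"
  shows "\<exists>m. (\<Sum>i<n. m i) = 0 \<and> (\<Sum>i<n. (m i)\<^sup>2) = 1 \<and>
    (\<forall>x. (\<Sum>i<n. x i) = 0 \<longrightarrow> energy P w m * (\<Sum>i<n. (x i)\<^sup>2) \<le> energy P w x)"
proof -
  define B :: "(nat \<Rightarrow> real) set" where "B = Pi\<^sub>E UNIV (\<lambda>i. if i < n then {-1..1} else {0})"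
  define S where "S = B \<inter> {x. (\<Sum>i<n. x i) = 0} \<inter> {x. (\<Sum>i<n. (x i)\<^sup>2) = 1}"
  define scaled where "scaled = (\<lambda>(x::nat\<Rightarrow>real) i. if i < n then x i / L2_set x {..<n} else 0)"
  have c: "continuous_on A (\<lambda>x::nat\<Rightarrow>real. x i)" for i A
    by (rule continuous_on_subset[OF continuous_on_product_coordinates]) simp
  have "compactin (product_topology (\<lambda>_. euclidean) UNIV) B"
    unfolding B_def compactin_PiE by simp
  then have "compact B" by (simp add: euclidean_product_topology)
  moreover have "closed {x::nat\<Rightarrow>real. (\<Sum>i<n. x i) = 0}" "closed {x::nat\<Rightarrow>real. (\<Sum>i<n. (x i)\<^sup>2) = 1}"
    by (intro closed_Collect_eq continuous_intros c)+
  ultimately have compact: "compact S" unfolding S_def by (intro compact_Int_closed) auto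
  have cont: "continuous_on S (energy P w)"
    unfolding energy_def grad_def case_prod_unfold by (intro continuous_intros c)
  have scale: "scaled x \<in> S"
    if x: "(\<Sum>i<n. x i) = 0" "(\<Sum>i<n. (x i)\<^sup>2) \<noteq> 0" for x
  proof -
    have pos: "0 < (\<Sum>i<n. (x i)\<^sup>2)" using x(2) by (simp add: less_le sum_nonneg)
    then have l: "0 < L2_set x {..<n}" by (simp add: L2_set_def)
    have le: "\<bar>x i\<bar> \<le> L2_set x {..<n}" if "i < n" for i
    proof -
      have "L2_set x {i} \<le> L2_set x {..<n}"
        unfolding L2_set_def using that by (intro real_sqrt_le_mono sum_mono2) auto
      then show ?thesis by (simp add: L2_set_def)
    qed
    have "(\<Sum>i<n. (x i / L2_set x {..<n})\<^sup>2) = 1"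
      using pos by (simp add: power_divide L2_set_def sum_nonneg flip: sum_divide_distrib)
    moreover have "(\<Sum>i<n. x i / L2_set x {..<n}) = 0" using x by (simp flip: sum_divide_distrib)
    moreover have "-1 \<le> x i / L2_set x {..<n} \<and> x i / L2_set x {..<n} \<le> 1" if "i < n" for i
    proof -
      have "\<bar>x i / L2_set x {..<n}\<bar> \<le> 1" using le[OF that] l by simp
      then show ?thesis by linarith
    qed
    ultimately show ?thesis by (auto simp: scaled_def S_def B_def PiE_def Pi_def)
  qed
  have "S \<noteq> {}"
  proof -
    define x where "x = (\<lambda>i. unit 0 i - unit 1 i)"
    have s: "(\<Sum>i<n. unit a i) = 1" if "a < n" for a
      using sum_unit(1)[OF that, of "\<lambda>_. 1"] by simp
    have "(\<Sum>i<n. x i) = 0" using n by (simp add: x_def sum_subtractf s)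
    moreover have "(x 0)\<^sup>2 \<le> (\<Sum>i<n. (x i)\<^sup>2)" using n by (intro member_le_sum) auto
    then have "(\<Sum>i<n. (x i)\<^sup>2) \<noteq> 0" by (auto simp: x_def unit_def)
    ultimately show ?thesis using scale[of x] by auto
  qed
  then obtain m where m: "m \<in> S" "\<And>y. y \<in> S \<Longrightarrow> energy P w m \<le> energy P w y"
    using continuous_attains_inf[OF compact _ cont] by blast
  have "energy P w m * (\<Sum>i<n. (x i)\<^sup>2) \<le> energy P w x" if x: "(\<Sum>i<n. x i) = 0" for x
  proof (cases "(\<Sum>i<n. (x i)\<^sup>2) = 0")
    case True
    then have "x i = 0" if "i < n" for i
      using that by (subst (asm) sum_nonneg_eq_0_iff) auto
    then have "energy P w x = 0"
      unfolding energy_def using P by (intro sum.neutral) (auto simp: grad_def)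
    with True show ?thesis by simp
  next
    case False
    then have pos: "0 < (\<Sum>i<n. (x i)\<^sup>2)" by (simp add: less_le sum_nonneg)
    have "energy P w (scaled x) = energy P w x / (\<Sum>i<n. (x i)\<^sup>2)"
      unfolding energy_def sum_divide_distrib
    proof (rule sum.cong[OF refl])
      fix e assume "e \<in> P"
      then have "grad (scaled x) e = grad x e / L2_set x {..<n}"
        using P by (auto simp: grad_def scaled_def diff_divide_distrib)
      then show "w e * (grad (scaled x) e)\<^sup>2 = w e * (grad x e)\<^sup>2 / (\<Sum>i<n. (x i)\<^sup>2)"
        by (simp add: power_divide L2_set_def sum_nonneg)
    qed
    with m(2)[OF scale[OF x False]] have "energy P w m \<le> energy P w x / (\<Sum>i<n. (x i)\<^sup>2)"
      by simp
    then show ?thesis using pos by (simp only: pos_le_divide_eq)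
  qed
  with m(1) show ?thesis by (intro exI[of _ m]) (auto simp: S_def)
qed

lemma linear_coefficient_0:
  fixes b c :: real
  assumes "\<And>t. 0 \<le> 2 * t * b + t\<^sup>2 * c"
  shows "b = 0"
proof (rule ccontr)
  assume b: "b \<noteq> 0"
  define s where "s = \<bar>c\<bar> + 1"
  have s: "s > 0" "c < s" by (auto simp: s_def)
  have "0 \<le> 2 * (- b / s) * b + (- b / s)\<^sup>2 * c" by (rule assms)
  also have "\<dots> = (b / s)\<^sup>2 * (c - 2 * s)"
    using s by (simp add: field_simps power2_eq_square)
  finally show False using s b by (simp add: zero_le_mult_iff)
qed

text \<open>
  First-order condition at the minimum of the Rayleigh quotient.  It is tested in the direction
  of the residual \<open>v\<close> of the eigenvalue equation, and it says that \<open>v\<close> is orthogonal to itself.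
\<close>
lemma energy_minimizer_eigen:
  assumes P: "P \<subseteq> {..<n} \<times> {..<n}"
    and m: "(\<Sum>i<n. m i) = 0" "(\<Sum>i<n. (m i)\<^sup>2) = 1"
    and min: "\<And>x. (\<Sum>i<n. x i) = 0 \<Longrightarrow> energy P w m * (\<Sum>i<n. (x i)\<^sup>2) \<le> energy P w x"
    and i: "i < n"
  shows "lap P w m i = energy P w m * m i"
proof -
  define \<mu> where "\<mu> = energy P w m"
  define v where "v = (\<lambda>i. lap P w m i - \<mu> * m i)"
  have lv: "(\<Sum>i<n. y i * lap P w m i) = (\<Sum>e\<in>P. w e * grad m e * grad y e)" for y
    unfolding lap_def by (rule sum_divg[OF P])
  have v0: "(\<Sum>i<n. v i) = 0"
    using lv[of "\<lambda>_. 1"] m(1) by (simp add: v_def sum_subtractf flip: sum_distrib_left)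
  define b where "b = (\<Sum>i<n. v i * v i)"
  have b: "b = (\<Sum>e\<in>P. w e * grad m e * grad v e) - \<mu> * (\<Sum>i<n. m i * v i)"
  proof -
    have "b = (\<Sum>i<n. v i * lap P w m i - \<mu> * (m i * v i))"
      unfolding b_def by (intro sum.cong) (auto simp: v_def algebra_simps)
    then show ?thesis by (simp only: sum_subtractf lv flip: sum_distrib_left)
  qed
  have "b = 0"
  proof (rule linear_coefficient_0)
    fix t
    define x where "x = (\<lambda>i. m i + t * v i)"
    have gx: "grad x e = grad m e + t * grad v e" for e
      by (simp add: x_def grad_def algebra_simps split: prod.splits)
    have "(\<Sum>i<n. x i) = 0" by (simp add: x_def sum.distrib m v0 flip: sum_distrib_left)
    from min[OF this] have "\<mu> * (\<Sum>i<n. (x i)\<^sup>2) \<le> energy P w x" by (simp add: \<mu>_def)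
    also have "energy P w x = \<mu> + 2 * t * (\<Sum>e\<in>P. w e * grad m e * grad v e) + t\<^sup>2 * energy P w v"
      unfolding \<mu>_def energy_def gx sum_distrib_left sum.distrib[symmetric]
      by (intro sum.cong) (auto simp: power2_eq_square algebra_simps)
    also have "(\<Sum>i<n. (x i)\<^sup>2) = (\<Sum>i<n. (m i)\<^sup>2) + 2 * t * (\<Sum>i<n. m i * v i) + t\<^sup>2 * (\<Sum>i<n. (v i)\<^sup>2)"
      unfolding x_def sum_distrib_left sum.distrib[symmetric]
      by (intro sum.cong) (auto simp: power2_eq_square algebra_simps)
    finally show "0 \<le> 2 * t * b + t\<^sup>2 * (energy P w v - \<mu> * (\<Sum>i<n. (v i)\<^sup>2))"
      using m(2) by (simp add: b algebra_simps)
  qed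
  then have "\<forall>i\<in>{..<n}. v i * v i = 0"
    unfolding b_def by (subst (asm) sum_nonneg_eq_0_iff) auto
  then show ?thesis using i by (simp add: v_def \<mu>_def)
qed

text \<open>
  The smaller element \<open>a\<close> precedes \<open>b\<close>, so \<open>b\<close> stands at position one or later.
\<close>
lemma sorted_nth_1_le:
  assumes "sorted xs" "a \<in> set xs" "b \<in> set xs" "a < b"
  shows "xs ! 1 \<le> b"
proof -
  obtain i j where ij: "i < length xs" "xs ! i = a" "j < length xs" "xs ! j = b"
    using assms by (auto simp: in_set_conv_nth)
  have "\<not> j \<le> i" using sorted_nth_mono[OF assms(1), of j i] ij assms(4) by auto
  then have "1 \<le> j" by simp
  then show ?thesis using sorted_nth_mono[OF assms(1), of 1 j] ij by simp
qed

lemma eigenvalue_laplacian: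
  assumes "simple_graph n E" "\<And>i. i < n \<Longrightarrow> lap (edges n E) (\<lambda>_. 1) x i = k * x i" "i < n" "x i \<noteq> 0"
  shows "poly (char_poly (laplacian n E)) k = 0"
proof -
  have C: "laplacian n E \<in> carrier_mat n n" unfolding laplacian_def by (rule minus_carrier_mat) simp
  have "(laplacian n E *\<^sub>v Matrix.vec n x) $ j = k * x j" if j: "j < n" for j
  proof -
    have "(laplacian n E *\<^sub>v Matrix.vec n x) $ j
        = (\<Sum>l<n. ((if j = l then degree_of n E l else 0) - adj E j l) * x l)"
      using j by (simp add: laplacian_def mat_diag_def scalar_prod_def atLeast0LessThan)
    also have "\<dots> = (\<Sum>l<n. (if j = l then degree_of n E l * x l else 0) - adj E j l * x l)"
      by (intro sum.cong) (auto simp: algebra_simps)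
    also have "\<dots> = lap (edges n E) (\<lambda>_. 1) x j"
      using j by (simp add: sum_subtractf lap_unweighted[OF assms(1)])
    finally show ?thesis using assms(2) j by simp
  qed
  then have "laplacian n E *\<^sub>v Matrix.vec n x = k \<cdot>\<^sub>v Matrix.vec n x"
    using C by (intro eq_vecI) auto
  moreover have "Matrix.vec n x \<noteq> 0\<^sub>v n"
  proof
    assume "Matrix.vec n x = 0\<^sub>v n"
    then have "Matrix.vec n x $ i = 0\<^sub>v n $ i" by simp
    with assms(3,4) show False by simp
  qed
  ultimately have "eigenvector (laplacian n E) (Matrix.vec n x) k"
    using C by (simp add: eigenvector_def)
  then show ?thesis using eigenvalue_root_char_poly[OF C] by (auto simp: eigenvalue_def)
qed

text \<open>
  The minimum \<open>\<mu>\<close> of the Rayleigh quotient over centred vectors is an eigenvalue, and it is positive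
  because the graph is connected.  So \<open>0 < \<mu>\<close> are two roots of the characteristic polynomial, and
  the second entry of the sorted list of roots is at most \<open>\<mu>\<close>.
\<close>
lemma lambda2_poincare:
  assumes G: "simple_graph n E" "connected_graph n E" and n: "2 \<le> n" and x: "(\<Sum>i<n. x i) = 0"
  shows "lambda2 n E * (\<Sum>i<n. (x i)\<^sup>2) \<le> energy (edges n E) (\<lambda>_. 1) x"
proof -
  let ?P = "edges n E"
  obtain m where m: "(\<Sum>i<n. m i) = 0" "(\<Sum>i<n. (m i)\<^sup>2) = 1"
    and min: "\<And>x. (\<Sum>i<n. x i) = 0 \<Longrightarrow> energy ?P (\<lambda>_. 1) m * (\<Sum>i<n. (x i)\<^sup>2) \<le> energy ?P (\<lambda>_. 1) x"
    using energy_minimizer[OF n edges_sub(2)] by metis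
  define \<mu> where "\<mu> = energy ?P (\<lambda>_. 1) m"
  obtain i where i: "i < n" "m i \<noteq> 0"
    using m(2) by (metis (no_types, lifting) lessThan_iff power_zero_numeral sum.neutral zero_neq_one)
  have "\<mu> \<noteq> 0"
  proof
    assume "\<mu> = 0"
    then have "grad m e = 0" if "e \<in> ?P" for e
      using that unfolding \<mu>_def energy_def
      by (subst (asm) sum_nonneg_eq_0_iff) (auto simp: finite_edges)
    then have "m j = m i" if "j < n" for j
      using connected_grad_0_imp_const[OF G] that i by blast
    then have "(\<Sum>j<n. m j) = n * m i" by simp
    with m(1) i n show False by simp
  qed
  moreover have "0 \<le> \<mu>" unfolding \<mu>_def energy_def by (intro sum_nonneg) auto
  ultimately have pos: "0 < \<mu>" by simp
  let ?p = "char_poly (laplacian n E)"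
  have C: "laplacian n E \<in> carrier_mat n n" unfolding laplacian_def by (rule minus_carrier_mat) simp
  have "?p \<noteq> 0" using degree_monic_char_poly[OF C] by auto
  moreover have "poly ?p \<mu> = 0"
    using eigenvalue_laplacian[OF G(1) _ i(1), where x = m and k = \<mu>] i(2) energy_minimizer_eigen[OF edges_sub(2) m min]
    by (simp add: \<mu>_def)
  moreover have "poly ?p 0 = 0"
    by (rule eigenvalue_laplacian[OF G(1) _ i(1), where x = "\<lambda>_. 1"]) (auto simp: lap_def divg_def)
  ultimately have "lambda2 n E \<le> \<mu>"
    unfolding lambda2_def using pos by (intro sorted_nth_1_le[where a = 0]) auto
  then have "lambda2 n E * (\<Sum>i<n. (x i)\<^sup>2) \<le> \<mu> * (\<Sum>i<n. (x i)\<^sup>2)"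
    by (intro mult_right_mono sum_nonneg) auto
  also have "\<dots> \<le> energy ?P (\<lambda>_. 1) x" unfolding \<mu>_def by (rule min[OF x])
  finally show ?thesis .
qed

section \<open>Concentration of the comparison noise\<close>

text \<open>
  The flow \<open>\<beta>\<close>: the gradient of the negative log-likelihood at the true parameter is \<open>- divg \<beta>\<close>.
\<close>
definition noise :: "nat \<Rightarrow> (nat \<Rightarrow> real) \<Rightarrow> (nat \<times> nat \<times> nat \<Rightarrow> bool) \<Rightarrow> nat \<times> nat \<Rightarrow> real" where
  "noise L \<theta> y = (\<lambda>(i, j). ybar L y i j - psi (\<theta> i - \<theta> j))"

lemma noise_eq: "noise L \<theta> y e = ybar L y (fst e) (snd e) - psi (grad \<theta> e)"
  by (simp add: noise_def grad_def split: prod.splits)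

text \<open>
  Hoeffding's lemma for a centred Bernoulli variable.  The analytic estimate is available for a
  nonnegative exponent; for a negative one, success and failure are exchanged.
\<close>
lemma bernoulli_mgf:
  assumes p: "0 \<le> p" "p \<le> 1"
  shows "measure_pmf.expectation (bernoulli_pmf p) (\<lambda>b. exp (a * (of_bool b - p))) \<le> exp (a\<^sup>2 / 8)"
proof -
  have *: "exp (h * (1 - q)) * q + exp (- (h * q)) * (1 - q) \<le> exp (h\<^sup>2 / 8)"
    if h: "0 \<le> h" and q: "0 \<le> q" "q \<le> 1" for h q :: real
  proof -
    have "1 \<le> exp h" using h by simp
    then have "0 \<le> q * (exp h - 1)" using q by (intro mult_nonneg_nonneg) auto
    then have pos: "0 < 1 + q * (exp h - 1)" by simp
    have "exp (h * (1 - q)) * q + exp (- (h * q)) * (1 - q) = exp (- h * q) * (1 + q * (exp h - 1))"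
      by (simp add: algebra_simps flip: exp_add)
    also have "\<dots> = exp (- h * q + ln (1 + q * (exp h - 1)))"
      using pos by (simp only: exp_add exp_ln)
    also have "\<dots> \<le> exp (h\<^sup>2 / 8)"
      using Hoeffdings_lemma_aux[OF h q(1)] by simp
    finally show ?thesis .
  qed
  have "measure_pmf.expectation (bernoulli_pmf p) (\<lambda>b. exp (a * (of_bool b - p)))
      = exp (a * (1 - p)) * p + exp (- (a * p)) * (1 - p)"
    using p by simp
  also have "\<dots> \<le> exp (a\<^sup>2 / 8)"
  proof (cases "0 \<le> a")
    case True
    then show ?thesis using * p by blast
  next
    case False
    then have "exp (- a * (1 - (1 - p))) * (1 - p) + exp (- (- a * (1 - p))) * (1 - (1 - p)) \<le> exp ((- a)\<^sup>2 / 8)"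
      using p by (intro *) auto
    then show ?thesis by (simp add: add.commute)
  qed
  finally show ?thesis .
qed

lemma finite_comparisons: "finite {(i, j, l). i < j \<and> j < (n::nat) \<and> (i, j) \<in> E \<and> l < (L::nat)}"
  by (rule finite_subset[of _ "{..<n} \<times> {..<n} \<times> {..<L}"]) auto

lemma finite_set_btl_pmf: "finite (set_pmf (btl_pmf n E L \<theta>))"
  unfolding btl_pmf_def set_Pi_pmf[OF finite_comparisons]
  by (intro finite_PiE_dflt finite_comparisons) simp

text \<open>
  The noise flow is sub-Gaussian with variance proxy \<open>1 / (4 L)\<close> on every edge.
\<close>
lemma noise_mgf:
  assumes L: "0 < L"
  shows "measure_pmf.expectation (btl_pmf n E L \<theta>) (\<lambda>y. exp (\<Sum>e\<in>edges n E. a e * noise L \<theta> y e))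
           \<le> exp ((\<Sum>e\<in>edges n E. (a e)\<^sup>2) / (8 * L))"
proof -
  let ?I = "{(i, j, l). i < j \<and> j < n \<and> (i, j) \<in> E \<and> l < L}"
  define p where "p = (\<lambda>(i, j, l::nat). psi (\<theta> i - \<theta> j))"
  define c where "c = (\<lambda>(i, j, l::nat). a (i, j) / L)"
  have reindex: "(\<Sum>x\<in>?I. g x) = (\<Sum>e\<in>edges n E. \<Sum>l<L. g (fst e, snd e, l))" for g :: "_ \<Rightarrow> real"
    unfolding sum.cartesian_product
    by (rule sum.reindex_bij_witness[of _ "\<lambda>(e, l). (fst e, snd e, l)" "\<lambda>(i, j, l). ((i, j), l)"])
       (auto simp: edges_def)
  have noise: "(\<Sum>e\<in>edges n E. a e * noise L \<theta> y e) = (\<Sum>x\<in>?I. c x * (of_bool (y x) - p x))" for y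
    unfolding reindex
  proof (intro sum.cong refl)
    fix e :: "nat \<times> nat"
    obtain i j where e: "e = (i, j)" by (cases e)
    have "(\<Sum>l<L. a e / L * (of_bool (y (i, j, l)) - psi (\<theta> i - \<theta> j)))
        = a e / L * ((\<Sum>l<L. of_bool (y (i, j, l))) - L * psi (\<theta> i - \<theta> j))"
      by (simp only: sum_distrib_left[symmetric] sum_subtractf sum_constant card_lessThan)
    also have "\<dots> = a e * noise L \<theta> y e"
      using L by (simp add: e noise_def ybar_def field_simps)
    finally show "a e * noise L \<theta> y e
        = (\<Sum>l<L. c (fst e, snd e, l) * (of_bool (y (fst e, snd e, l)) - p (fst e, snd e, l)))"
      by (simp add: e c_def p_def)
  qed
  have p: "0 \<le> p x" "p x \<le> 1" for x
    by (cases x; simp add: p_def less_imp_le[OF psi_pos] less_imp_le[OF psi_less_one])+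
  have "measure_pmf.expectation (btl_pmf n E L \<theta>) (\<lambda>y. exp (\<Sum>e\<in>edges n E. a e * noise L \<theta> y e))
      = measure_pmf.expectation (Pi_pmf ?I False (\<lambda>x. bernoulli_pmf (p x)))
          (\<lambda>y. \<Prod>x\<in>?I. exp (c x * (of_bool (y x) - p x)))"
    unfolding noise exp_sum[OF finite_comparisons] btl_pmf_def p_def by (simp add: case_prod_unfold)
  also have "\<dots> = (\<Prod>x\<in>?I. measure_pmf.expectation (bernoulli_pmf (p x)) (\<lambda>v. exp (c x * (of_bool v - p x))))"
    by (rule expectation_prod_Pi_pmf[OF finite_comparisons])
       (auto intro!: integrable_measure_pmf_finite)
  also have "\<dots> \<le> (\<Prod>x\<in>?I. exp ((c x)\<^sup>2 / 8))"
    by (intro prod_mono conjI bernoulli_mgf p Bochner_Integration.integral_nonneg) simp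
  also have "\<dots> = exp (\<Sum>x\<in>?I. (c x)\<^sup>2 / 8)" by (rule exp_sum[OF finite_comparisons, symmetric])
  also have "(\<Sum>x\<in>?I. (c x)\<^sup>2 / 8) = (\<Sum>e\<in>edges n E. (a e)\<^sup>2) / (8 * L)"
    unfolding reindex sum_divide_distrib using L
    by (intro sum.cong) (simp_all add: c_def power2_eq_square field_simps)
  finally show ?thesis .
qed

lemma pmf_markov:
  fixes X :: "'a \<Rightarrow> real"
  assumes "finite (set_pmf M)" "\<And>y. 0 \<le> X y" "0 < c"
  shows "measure_pmf.prob M {y. c \<le> X y} \<le> measure_pmf.expectation M X / c"
  using integral_Markov_inequality_measure[of "measure_pmf M" X UNIV c] assms
  by (auto intro: integrable_measure_pmf_finite)

lemma noise_tail_one_sided: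
  assumes L: "0 < L" and S: "0 < S" "(\<Sum>e\<in>edges n E. (v e)\<^sup>2) \<le> S" and t: "0 \<le> t"
  shows "measure_pmf.prob (btl_pmf n E L \<theta>) {y. t \<le> (\<Sum>e\<in>edges n E. v e * noise L \<theta> y e)}
           \<le> exp (- (2 * real L * t\<^sup>2 / S))"
proof -
  let ?M = "btl_pmf n E L \<theta>" and ?X = "\<lambda>y. \<Sum>e\<in>edges n E. v e * noise L \<theta> y e"
  \<comment> \<open>the minimizer of the Chernoff exponent \<open>s\<^sup>2 * S / (8 * L) - s * t\<close>\<close>
  define s where "s = 4 * L * t / S"
  have s: "0 \<le> s" using t S by (simp add: s_def)
  have "measure_pmf.prob ?M {y. t \<le> ?X y} \<le> measure_pmf.prob ?M {y. exp (s * t) \<le> exp (s * ?X y)}"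
    using s by (intro measure_pmf.finite_measure_mono) (auto intro: mult_left_mono)
  also have "\<dots> \<le> measure_pmf.expectation ?M (\<lambda>y. exp (s * ?X y)) / exp (s * t)"
    by (rule pmf_markov[OF finite_set_btl_pmf]) auto
  also have "measure_pmf.expectation ?M (\<lambda>y. exp (s * ?X y)) \<le> exp ((\<Sum>e\<in>edges n E. (s * v e)\<^sup>2) / (8 * L))"
    using noise_mgf[OF L, of n E \<theta> "\<lambda>e. s * v e"] by (simp add: sum_distrib_left mult.assoc)
  also have "(\<Sum>e\<in>edges n E. (s * v e)\<^sup>2) / (8 * L) \<le> s\<^sup>2 * S / (8 * L)"
    using S by (simp add: power_mult_distrib divide_right_mono mult_left_mono flip: sum_distrib_left)
  also have "exp (s\<^sup>2 * S / (8 * L)) / exp (s * t) = exp (- (2 * real L * t\<^sup>2 / S))"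
    using L S by (simp add: s_def power2_eq_square field_simps flip: exp_diff)
  finally show ?thesis by (simp add: divide_right_mono)
qed

text \<open>
  The factor 3 under the root gives each of the two one-sided deviations probability
  \<open>1 / n ^ 6\<close>, which leaves \<open>2 / n ^ 5\<close> after the union over \<open>n\<close> coefficient vectors.
\<close>
lemma noise_tail_union:
  assumes L: "0 < L" and n: "2 \<le> n" and S: "0 < S"
    and V: "\<And>i. i < n \<Longrightarrow> (\<Sum>e\<in>edges n E. (V i e)\<^sup>2) \<le> S"
  shows "measure_pmf.prob (btl_pmf n E L \<theta>)
           {y. \<exists>i<n. sqrt (3 * S * ln n / L) < \<bar>\<Sum>e\<in>edges n E. V i e * noise L \<theta> y e\<bar>} \<le> 2 / real n ^ 5"
proof -
  let ?M = "btl_pmf n E L \<theta>"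
  define t where "t = sqrt (3 * S * ln n / L)"
  define A where "A v = {y. t \<le> (\<Sum>e\<in>edges n E. v e * noise L \<theta> y e)}" for v
  have lnn: "0 \<le> ln (real n)" using n by simp
  have t: "0 \<le> t" "t\<^sup>2 = 3 * S * ln n / L" using S lnn by (simp_all add: t_def)
  have bound: "measure_pmf.prob ?M (A v) \<le> 1 / real n ^ 6" if "(\<Sum>e\<in>edges n E. (v e)\<^sup>2) \<le> S" for v
  proof -
    have "measure_pmf.prob ?M (A v) \<le> exp (- (2 * real L * t\<^sup>2 / S))"
      unfolding A_def by (rule noise_tail_one_sided[OF L S that t(1)])
    also have "- (2 * real L * t\<^sup>2 / S) = - (6 * ln n)" using L S by (simp add: t)
    also have "exp (- (6 * ln (real n))) = 1 / real n ^ 6"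
      using n exp_of_nat_mult[of 6 "ln (real n)"] by (simp add: exp_minus field_simps)
    finally show ?thesis .
  qed
  have "measure_pmf.prob ?M {y. \<exists>i<n. t < \<bar>\<Sum>e\<in>edges n E. V i e * noise L \<theta> y e\<bar>}
      \<le> measure_pmf.prob ?M (\<Union>i<n. A (V i) \<union> A (\<lambda>e. - V i e))"
    by (intro measure_pmf.finite_measure_mono) (auto simp: A_def sum_negf abs_if split: if_splits)
  also have "\<dots> \<le> (\<Sum>i<n. measure_pmf.prob ?M (A (V i) \<union> A (\<lambda>e. - V i e)))"
    by (intro measure_pmf.finite_measure_subadditive_finite) auto
  also have "\<dots> \<le> (\<Sum>i<n. 2 / real n ^ 6)"
  proof (rule sum_mono)
    fix i assume "i \<in> {..<n}"
    then have i: "i < n" by simp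
    have "measure_pmf.prob ?M (A (V i) \<union> A (\<lambda>e. - V i e))
        \<le> measure_pmf.prob ?M (A (V i)) + measure_pmf.prob ?M (A (\<lambda>e. - V i e))"
      by (intro measure_Un_le) auto
    also have "\<dots> \<le> 1 / real n ^ 6 + 1 / real n ^ 6"
      using V[OF i] by (intro add_mono bound) auto
    finally show "measure_pmf.prob ?M (A (V i) \<union> A (\<lambda>e. - V i e)) \<le> 2 / real n ^ 6" by simp
  qed
  also have "\<dots> = 2 / real n ^ 5" using n by (simp add: field_simps eval_nat_numeral)
  finally show ?thesis by (simp add: t_def)
qed

lemma has_bochner_integral_le:
  fixes f g :: "'a \<Rightarrow> real"
  assumes "has_bochner_integral M f a" "has_bochner_integral M g b" "\<And>x. f x \<le> g x"
  shows "a \<le> b"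
  using assms integral_mono[of M f g] by (simp add: has_bochner_integral_iff)

lemma std_normal_mgf:
  "has_bochner_integral lborel (\<lambda>s. std_normal_density s * exp (s * a)) (exp (a\<^sup>2 / 2))"
proof -
  have "has_bochner_integral lborel (\<lambda>s. exp (a\<^sup>2 / 2) * normal_density a 1 s) (exp (a\<^sup>2 / 2) * 1)"
    using integrable_normal_density[of 1 a] integral_normal_density[of 1 a]
    by (intro has_bochner_integral_mult_right) (simp add: has_bochner_integral_iff)
  moreover have "exp (a\<^sup>2 / 2) * normal_density a 1 s = std_normal_density s * exp (s * a)" for s
    by (simp add: normal_density_def power2_eq_square field_simps flip: exp_add)
  ultimately show ?thesis by simp
qed

lemma std_normal_exp_square:
  "has_bochner_integral lborel (\<lambda>s. std_normal_density s * exp (s\<^sup>2 / 4)) (sqrt 2)"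
proof -
  have "has_bochner_integral lborel (\<lambda>s. sqrt 2 * normal_density 0 (sqrt 2) s) (sqrt 2 * 1)"
    using integrable_normal_density[of "sqrt 2" 0] integral_normal_density[of "sqrt 2" 0]
    by (intro has_bochner_integral_mult_right) (simp add: has_bochner_integral_iff)
  moreover have "sqrt 2 * normal_density 0 (sqrt 2) s = std_normal_density s * exp (s\<^sup>2 / 4)" for s
    by (simp add: normal_density_def real_sqrt_mult field_simps flip: exp_add)
  ultimately show ?thesis by simp
qed

text \<open>
  Linearisation of the square by a Gaussian variable: \<open>exp (x\<^sup>2 / 2)\<close> is the mean of \<open>exp (s * x)\<close> over a
  standard normal \<open>s\<close>.  The squares are treated one coordinate at a time, so that only
  one-dimensional integrals and interchanges with finite sums occur; each coordinate
  costs the mean \<open>sqrt 2\<close> of \<open>exp (s\<^sup>2 / 4)\<close>.  A union bound over the coordinates would lose a factor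
  \<open>ln n\<close> in the sum of squares.
\<close>
lemma subgaussian_vector_exp_square:
  fixes X :: "nat \<Rightarrow> 'a \<Rightarrow> real"
  assumes fin: "finite (set_pmf M)"
    and mgf: "\<And>z. measure_pmf.expectation M (\<lambda>y. exp (\<Sum>i<m. z i * X i y)) \<le> exp ((\<Sum>i<m. (z i)\<^sup>2) / 4)"
  shows "measure_pmf.expectation M (\<lambda>y. exp ((\<Sum>i<m. (X i y)\<^sup>2) / 2)) \<le> sqrt 2 ^ m"
proof -
  \<comment> \<open>the exponent once the first \<open>k\<close> coordinates have been squared\<close>
  define A where "A k z y = (\<Sum>i<k. (X i y)\<^sup>2) / 2 + (\<Sum>i\<in>{k..<m}. z i * X i y)" for k z y
  have expect: "measure_pmf.expectation M f = (\<Sum>y\<in>set_pmf M. f y * pmf M y)" for f :: "'a \<Rightarrow> real"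
    by (rule integral_measure_pmf_real[OF fin])
  have "k \<le> m \<Longrightarrow> measure_pmf.expectation M (\<lambda>y. exp (A k z y))
          \<le> sqrt 2 ^ k * exp ((\<Sum>i\<in>{k..<m}. (z i)\<^sup>2) / 4)" for k z
  proof (induction k arbitrary: z)
    case 0
    then show ?case using mgf[of z] by (simp add: A_def atLeast0LessThan)
  next
    case (Suc k)
    then have k: "k < m" by simp
    then have ivl: "{k..<m} = insert k {Suc k..<m}" by auto
    have split: "exp (A k (z(k := s)) y) = exp (s * X k y) * exp (A (Suc k) z y - (X k y)\<^sup>2 / 2)" for s y
    proof -
      have "(\<Sum>i\<in>{k..<m}. (z(k := s)) i * X i y) = s * X k y + (\<Sum>i\<in>{Suc k..<m}. z i * X i y)"
        unfolding ivl by (subst sum.insert) (auto intro!: sum.cong)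
      then show ?thesis by (simp add: A_def add_divide_distrib flip: exp_add)
    qed
    have lhs: "has_bochner_integral lborel
        (\<lambda>s. \<Sum>y\<in>set_pmf M. (exp (A (Suc k) z y - (X k y)\<^sup>2 / 2) * pmf M y) * (std_normal_density s * exp (s * X k y)))
        (\<Sum>y\<in>set_pmf M. (exp (A (Suc k) z y - (X k y)\<^sup>2 / 2) * pmf M y) * exp ((X k y)\<^sup>2 / 2))"
      by (intro has_bochner_integral_sum has_bochner_integral_mult_right std_normal_mgf)
    have rhs: "has_bochner_integral lborel
        (\<lambda>s. (sqrt 2 ^ k * exp ((\<Sum>i\<in>{Suc k..<m}. (z i)\<^sup>2) / 4)) * (std_normal_density s * exp (s\<^sup>2 / 4)))
        ((sqrt 2 ^ k * exp ((\<Sum>i\<in>{Suc k..<m}. (z i)\<^sup>2) / 4)) * sqrt 2)"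
      by (intro has_bochner_integral_mult_right std_normal_exp_square)
    have le: "(\<Sum>y\<in>set_pmf M. (exp (A (Suc k) z y - (X k y)\<^sup>2 / 2) * pmf M y) * (std_normal_density s * exp (s * X k y)))
        \<le> (sqrt 2 ^ k * exp ((\<Sum>i\<in>{Suc k..<m}. (z i)\<^sup>2) / 4)) * (std_normal_density s * exp (s\<^sup>2 / 4))" for s
    proof -
      have "(\<Sum>y\<in>set_pmf M. (exp (A (Suc k) z y - (X k y)\<^sup>2 / 2) * pmf M y) * (std_normal_density s * exp (s * X k y)))
          = std_normal_density s * measure_pmf.expectation M (\<lambda>y. exp (A k (z(k := s)) y))"
        unfolding expect split by (simp add: sum_distrib_left mult_ac)
      also have "\<dots> \<le> std_normal_density s * (sqrt 2 ^ k * exp ((\<Sum>i\<in>{k..<m}. ((z(k := s)) i)\<^sup>2) / 4))"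
        using k by (intro mult_left_mono Suc.IH) auto
      also have "(\<Sum>i\<in>{k..<m}. ((z(k := s)) i)\<^sup>2) = s\<^sup>2 + (\<Sum>i\<in>{Suc k..<m}. (z i)\<^sup>2)"
        unfolding ivl by (subst sum.insert) (auto intro!: sum.cong)
      finally show ?thesis by (simp add: add_divide_distrib exp_add mult_ac)
    qed
    have "measure_pmf.expectation M (\<lambda>y. exp (A (Suc k) z y))
        = (\<Sum>y\<in>set_pmf M. (exp (A (Suc k) z y - (X k y)\<^sup>2 / 2) * pmf M y) * exp ((X k y)\<^sup>2 / 2))"
      unfolding expect by (intro sum.cong) (auto simp: exp_diff)
    also have "\<dots> \<le> (sqrt 2 ^ k * exp ((\<Sum>i\<in>{Suc k..<m}. (z i)\<^sup>2) / 4)) * sqrt 2"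
      using lhs rhs le by (rule has_bochner_integral_le)
    finally show ?case by (simp add: mult_ac)
  qed
  from this[of m "\<lambda>_. 0"] show ?thesis by (simp add: A_def)
qed

text \<open>
  The Laplacian is bounded by \<open>2 n_max\<close>, so \<open>divg \<beta>\<close> scaled by \<open>sqrt (L / n_max)\<close> satisfies the moment
  bound of the preceding lemma.  Markov's inequality then gives the probability
  \<open>sqrt 2 ^ n * exp (- 2 n) \<le> exp (- n)\<close>, and \<open>exp n \<ge> (n / 5) ^ 5\<close>.
\<close>
lemma noise_divg_norm_tail:
  assumes L: "0 < L" and n: "2 \<le> n" and G: "simple_graph n E" and nmax: "0 < n_max n E"
  shows "measure_pmf.prob (btl_pmf n E L \<theta>)
           {y. sqrt (4 * real n * n_max n E / L) < L2_set (divg (edges n E) (noise L \<theta> y)) {..<n}} \<le> 3125 / real n ^ 5"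
proof -
  let ?M = "btl_pmf n E L \<theta>" and ?P = "edges n E"
  define t where "t = sqrt (L / n_max n E)"
  have t2: "t\<^sup>2 = L / n_max n E" using nmax by (simp add: t_def)
  define b where "b = (\<lambda>y. divg ?P (noise L \<theta> y))"
  have "measure_pmf.expectation ?M (\<lambda>y. exp (\<Sum>i<n. z i * (t * b y i))) \<le> exp ((\<Sum>i<n. (z i)\<^sup>2) / 4)" for z
  proof -
    have "(\<Sum>i<n. z i * (t * b y i)) = (\<Sum>e\<in>?P. (t * grad z e) * noise L \<theta> y e)" for y
    proof -
      have "(\<Sum>i<n. z i * (t * b y i)) = t * (\<Sum>i<n. z i * b y i)"
        by (simp add: sum_distrib_left mult_ac)
      also have "\<dots> = t * (\<Sum>e\<in>?P. noise L \<theta> y e * grad z e)"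
        unfolding b_def by (simp add: sum_divg[OF edges_sub(2)])
      finally show ?thesis by (simp add: sum_distrib_left mult_ac)
    qed
    then have "measure_pmf.expectation ?M (\<lambda>y. exp (\<Sum>i<n. z i * (t * b y i)))
        \<le> exp ((\<Sum>e\<in>?P. (t * grad z e)\<^sup>2) / (8 * L))"
      using noise_mgf[OF L] by simp
    also have "(\<Sum>e\<in>?P. (t * grad z e)\<^sup>2) = (L / n_max n E) * (\<Sum>e\<in>?P. (grad z e)\<^sup>2)"
      by (simp add: power_mult_distrib t2 sum_distrib_left)
    also have "(L / n_max n E) * (\<Sum>e\<in>?P. (grad z e)\<^sup>2) / (8 * L)
        \<le> (L / n_max n E) * (2 * n_max n E * (\<Sum>i<n. (z i)\<^sup>2)) / (8 * L)"
      using nmax by (intro divide_right_mono mult_left_mono energy_le_degree[OF G]) auto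
    also have "\<dots> = (\<Sum>i<n. (z i)\<^sup>2) / 4" using nmax L by simp
    finally show ?thesis by simp
  qed
  then have mgf: "measure_pmf.expectation ?M (\<lambda>y. exp ((\<Sum>i<n. (t * b y i)\<^sup>2) / 2)) \<le> sqrt 2 ^ n"
    by (rule subgaussian_vector_exp_square[OF finite_set_btl_pmf])
  have "measure_pmf.prob ?M {y. sqrt (4 * real n * n_max n E / L) < L2_set (b y) {..<n}}
      \<le> measure_pmf.prob ?M {y. exp (2 * real n) \<le> exp ((\<Sum>i<n. (t * b y i)\<^sup>2) / 2)}"
  proof (intro measure_pmf.finite_measure_mono subsetI)
    fix y assume "y \<in> {y. sqrt (4 * real n * n_max n E / L) < L2_set (b y) {..<n}}"
    then have "4 * real n * n_max n E / L < (\<Sum>i<n. (b y i)\<^sup>2)" by (simp add: L2_set_def)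
    then have "(L / n_max n E) * (4 * real n * n_max n E / L) \<le> (L / n_max n E) * (\<Sum>i<n. (b y i)\<^sup>2)"
      using L nmax by (intro mult_left_mono) auto
    then have "4 * real n \<le> (\<Sum>i<n. (t * b y i)\<^sup>2)"
      using L nmax by (simp add: power_mult_distrib t2 sum_distrib_left)
    then show "y \<in> {y. exp (2 * real n) \<le> exp ((\<Sum>i<n. (t * b y i)\<^sup>2) / 2)}" by simp
  qed auto
  also have "\<dots> \<le> measure_pmf.expectation ?M (\<lambda>y. exp ((\<Sum>i<n. (t * b y i)\<^sup>2) / 2)) / exp (2 * real n)"
    by (rule pmf_markov[OF finite_set_btl_pmf]) auto
  also have "\<dots> \<le> exp (real n) / exp (2 * real n)"
  proof (rule divide_right_mono)
    have "sqrt 2 \<le> exp (1::real)"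
      using exp_ge_add_one_self[of 1] real_sqrt_le_mono[of 2 4] by simp
    then have "sqrt 2 ^ n \<le> exp 1 ^ n" by (intro power_mono) auto
    then show "measure_pmf.expectation ?M (\<lambda>y. exp ((\<Sum>i<n. (t * b y i)\<^sup>2) / 2)) \<le> exp (real n)"
      using mgf by (simp add: exp_of_nat_mult[symmetric])
  qed auto
  also have "exp (2 * real n) = exp (real n) * exp (real n)" by (simp flip: exp_add)
  also have "exp (real n) / (exp (real n) * exp (real n)) = 1 / exp (real n)" by simp
  also have "\<dots> \<le> 3125 / real n ^ 5"
  proof -
    have "(real n / 5) ^ 5 \<le> (1 + real n / 5) ^ 5" by (intro power_mono) auto
    also have "\<dots> \<le> exp (real n)" using exp_ge_one_plus_x_over_n_power_n[of 5 "real n"] by simp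
    finally show ?thesis using n by (simp add: power_divide field_simps)
  qed
  finally show ?thesis by (simp add: b_def)
qed

section \<open>The score equation\<close>

lemma neg_loglik_eq:
  "neg_loglik n E L y \<theta> = (\<Sum>e\<in>edges n E. edge_loss (ybar L y (fst e) (snd e)) (grad \<theta> e))"
proof -
  have "(\<Sum>e\<in>edges n E. edge_loss (ybar L y (fst e) (snd e)) (grad \<theta> e))
      = (\<Sum>e\<in>{(i, j). i < j \<and> j < n}. adj E (fst e) (snd e) * edge_loss (ybar L y (fst e) (snd e)) (grad \<theta> e))"
  proof (rule sum.mono_neutral_cong_left)
    show "finite {(i, j). i < j \<and> j < n}" by (rule finite_subset[of _ "{..<n} \<times> {..<n}"]) auto
  qed (auto simp: edges_def adj_def)
  also have "\<dots> = neg_loglik n E L y \<theta>"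
    unfolding neg_loglik_def sum_negf[symmetric]
    by (intro sum.cong) (auto simp: edge_loss_def grad_def algebra_simps)
  finally show ?thesis ..
qed

text \<open>
  At a zero of the gradient the linear parts of the tangent inequalities of the edges cancel, so
  every other parameter has a loss at least as large.  Equality forces equal
  differences along all edges, hence equality up to a constant, which centring removes.
\<close>
lemma score_zero_imp_unique_mle:
  assumes G: "simple_graph n E" "connected_graph n E" and n: "0 < n"
    and sum0: "(\<Sum>i<n. \<theta> i) = 0"
    and score: "\<And>i. i < n \<Longrightarrow> divg (edges n E) (\<lambda>e. psi (grad \<theta> e) - ybar L y (fst e) (snd e)) i = 0"
  shows "is_mle n E L y \<theta>" "is_mle n E L y \<theta>' \<Longrightarrow> i < n \<Longrightarrow> \<theta>' i = \<theta> i"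
proof -
  let ?P = "edges n E" and ?a = "\<lambda>e. ybar L y (fst e) (snd e)"
  let ?l = "neg_loglik n E L y"
  have lin: "(\<Sum>e\<in>?P. (psi (grad \<theta> e) - ?a e) * (grad \<eta> e - grad \<theta> e)) = 0" for \<eta>
    using sum_divg[OF edges_sub(2)[of n E], of "\<lambda>i. \<eta> i - \<theta> i" "\<lambda>e. psi (grad \<theta> e) - ?a e"] score
    by (simp add: grad_diff)
  have tangent: "edge_loss (?a e) (grad \<theta> e) + (psi (grad \<theta> e) - ?a e) * (grad \<eta> e - grad \<theta> e)
      \<le> edge_loss (?a e) (grad \<eta> e)" for \<eta> e
    using edge_loss_strict_tangent[of "grad \<eta> e" "grad \<theta> e" "?a e"]
    by (cases "grad \<eta> e = grad \<theta> e") auto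
  have l: "?l \<theta> = (\<Sum>e\<in>?P. edge_loss (?a e) (grad \<theta> e) + (psi (grad \<theta> e) - ?a e) * (grad \<eta> e - grad \<theta> e))" for \<eta>
    by (simp only: neg_loglik_eq sum.distrib lin add_0_right)
  have le: "?l \<theta> \<le> ?l \<eta>" for \<eta>
    unfolding l[of \<eta>] unfolding neg_loglik_eq by (intro sum_mono tangent)
  then show mle: "is_mle n E L y \<theta>"
    using sum0 by (auto simp: is_mle_def is_arg_min_def not_less)
  assume m: "is_mle n E L y \<theta>'" and i: "i < n"
  then have sum0': "(\<Sum>i<n. \<theta>' i) = 0" and "\<not> ?l \<theta> < ?l \<theta>'"
    using sum0 by (auto simp: is_mle_def is_arg_min_def)
  have "grad (\<lambda>i. \<theta>' i - \<theta> i) e = 0" if e: "e \<in> ?P" for e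
  proof (rule ccontr)
    assume "grad (\<lambda>i. \<theta>' i - \<theta> i) e \<noteq> 0"
    then have "grad \<theta>' e \<noteq> grad \<theta> e" by (simp add: grad_diff)
    then have "?l \<theta> < ?l \<theta>'"
      unfolding l[of \<theta>'] unfolding neg_loglik_eq
      by (intro sum_strict_mono_ex1 finite_edges ballI bexI[OF _ e] tangent edge_loss_strict_tangent)
    with \<open>\<not> ?l \<theta> < ?l \<theta>'\<close> show False by simp
  qed
  then have c: "\<theta>' j - \<theta> j = \<theta>' i - \<theta> i" if "j < n" for j
    using connected_grad_0_imp_const[OF G, of "\<lambda>i. \<theta>' i - \<theta> i" j i] that i by simp
  have "(\<Sum>j<n. \<theta>' j - \<theta> j) = n * (\<theta>' i - \<theta> i)" using c by simp
  then show "\<theta>' i = \<theta> i" using sum0 sum0' n by (simp add: sum_subtractf)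
qed

section \<open>Perturbation of the score equation\<close>

text \<open>
  The deterministic assumptions on the design.  The constant 65536 is \<open>64 * 1024\<close>: it has to make
  the product of the energy norms in \<open>Q_R_small\<close> at most \<open>1 / 32\<close>.
\<close>
locale btl_design =
  fixes n L :: nat and E :: "(nat \<times> nat) set" and \<theta> :: "nat \<Rightarrow> real"
  assumes n2: "2 \<le> n"
    and graph: "simple_graph n E" "connected_graph n E"
    and snr: "(lambda2 n E)\<^sup>2 * real L
      > 65536 * exp (2 * kappa_E E \<theta>) * (exp (2 * kappa_E E \<theta>) * n * ((n_max n E)\<^sup>2 / (n_min n E)\<^sup>2))"
    and gap: "lambda2 n E \<ge> 2 * exp (2 * kappa_E E \<theta>) * n_max n E / n_min n E"
begin

abbreviation "P \<equiv> edges n E"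
abbreviation "M \<equiv> n_max n E"
abbreviation "m \<equiv> n_min n E"
abbreviation "\<Lambda> \<equiv> lambda2 n E"

definition a :: real where "a = exp (kappa_E E \<theta>)"
definition w :: "nat \<times> nat \<Rightarrow> real" where "w e = dpsi (grad \<theta> e)"
text \<open>
  The spectral gap of the weighted Laplacian: the weights are at least \<open>1 / (4 * a)\<close>.
\<close>
definition \<mu> :: real where "\<mu> = \<Lambda> / (4 * a)"
text \<open>
  The first summand of the supremum rate.
\<close>
definition \<epsilon> :: real where "\<epsilon> = a * sqrt (M * ln n / (L * m\<^sup>2))"

lemma m_pos: "0 < m" and m_le_M: "m \<le> M"
proof -
  have "0 \<in> {..<n}" using n2 by simp
  then have "m \<in> degree_of n E ` {..<n}" unfolding n_min_def by (intro Min_in) auto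
  then show "0 < m" using connected_degree_ge_1[OF graph n2] by force
  show "m \<le> M" using degree_bounds[of 0 n E] n2 by simp
qed

lemma M_pos: "0 < M"
  using m_pos m_le_M by simp

lemma kappa_E_nonneg: "0 \<le> kappa_E E \<theta>" and grad_le_kappa_E: "e \<in> P \<Longrightarrow> \<bar>grad \<theta> e\<bar> \<le> kappa_E E \<theta>"
proof -
  have fin: "finite E"
    using graph(1) by (auto simp: simple_graph_def intro: finite_subset[of E "{..<n} \<times> {..<n}"])
  have le: "\<bar>\<theta> i - \<theta> j\<bar> \<le> kappa_E E \<theta>" if "(i, j) \<in> E" for i j
    unfolding kappa_E_def using fin that by (intro Max_ge) auto
  show "e \<in> P \<Longrightarrow> \<bar>grad \<theta> e\<bar> \<le> kappa_E E \<theta>" using le by (auto simp: edges_def grad_def)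
  have "E \<noteq> {}"
    using connected_degree_ge_1[OF graph n2, of 0] n2 by (auto simp: degree_of_def adj_def)
  then show "0 \<le> kappa_E E \<theta>" using le by (metis abs_ge_zero equals0I order_trans surj_pair)
qed

lemma a_ge_1: "1 \<le> a"
  using kappa_E_nonneg by (simp add: a_def)

lemma exp_2_kappa_E: "exp (2 * kappa_E E \<theta>) = a\<^sup>2"
  by (simp add: a_def power2_eq_square flip: exp_add)

lemma \<Lambda>_lower: "2 * a\<^sup>2 * M / m \<le> \<Lambda>"
  using gap by (simp add: exp_2_kappa_E)

lemma \<Lambda>_pos: "0 < \<Lambda>"
  using \<Lambda>_lower M_pos m_pos a_ge_1 by (intro less_le_trans[OF _ \<Lambda>_lower] divide_pos_pos mult_pos_pos) auto

lemma L_pos: "0 < L"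
proof (rule ccontr)
  assume "\<not> 0 < L"
  then have "\<Lambda>\<^sup>2 * real L = 0" by simp
  moreover have "0 \<le> 65536 * exp (2 * kappa_E E \<theta>) * (exp (2 * kappa_E E \<theta>) * n * (M\<^sup>2 / m\<^sup>2))" by simp
  ultimately show False using snr by linarith
qed

text \<open>
  The left-hand side is the square of \<open>sqrt Q * R\<close> for the quantities \<open>Q\<close> and \<open>R\<close> defined below.
\<close>
lemma snr_bound: "64 * a ^ 3 * n * M / (m * \<Lambda>\<^sup>2 * L) \<le> 1 / 1024"
proof -
  have "65536 * a ^ 3 * n * M * m \<le> 65536 * a ^ 4 * n * (M * M)"
  proof -
    have "a ^ 3 \<le> a ^ 4" using a_ge_1 by (intro power_increasing) auto
    moreover have "M * m \<le> M * M" using m_le_M M_pos by simp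
    ultimately have "a ^ 3 * (M * m) \<le> a ^ 4 * (M * M)"
      using M_pos m_pos a_ge_1 by (intro mult_mono) auto
    then have "(65536 * n) * (a ^ 3 * (M * m)) \<le> (65536 * n) * (a ^ 4 * (M * M))"
      by (intro mult_left_mono) auto
    then show ?thesis by (simp add: mult_ac)
  qed
  also have "\<dots> = 65536 * a\<^sup>2 * (a\<^sup>2 * n * (M\<^sup>2 / m\<^sup>2)) * m\<^sup>2"
    using m_pos by (simp add: power2_eq_square eval_nat_numeral)
  also have "\<dots> \<le> \<Lambda>\<^sup>2 * L * m\<^sup>2"
    using snr by (intro mult_right_mono) (auto simp: exp_2_kappa_E)
  finally have "m * (65536 * a ^ 3 * n * M) \<le> m * (m * \<Lambda>\<^sup>2 * L)"
    by (simp add: power2_eq_square mult_ac)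
  then have "65536 * a ^ 3 * n * M \<le> m * \<Lambda>\<^sup>2 * L" using m_pos by simp
  moreover have "0 < m * \<Lambda>\<^sup>2 * L" using m_pos \<Lambda>_pos L_pos by simp
  ultimately show ?thesis by (simp add: divide_le_eq)
qed

lemma w_bounds:
  assumes "e \<in> P"
  shows "1 / (4 * a) \<le> w e" "w e \<le> 1 / 4"
proof -
  have "exp (- kappa_E E \<theta>) \<le> exp (- \<bar>grad \<theta> e\<bar>)" using grad_le_kappa_E[OF assms] by simp
  then have "exp (- kappa_E E \<theta>) / 4 \<le> w e"
    using dpsi_lower[of "grad \<theta> e"] unfolding w_def by linarith
  then show "1 / (4 * a) \<le> w e" by (simp add: a_def exp_minus field_simps)
  show "w e \<le> 1 / 4" unfolding w_def by (rule dpsi_le_quarter)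
qed

lemma grad_square_le_energy: "(\<Sum>e\<in>P. (grad x e)\<^sup>2) \<le> 4 * a * energy P w x"
proof -
  have "(\<Sum>e\<in>P. (1 / (4 * a)) * (grad x e)\<^sup>2) \<le> energy P w x"
    unfolding energy_def using w_bounds(1) by (intro sum_mono mult_right_mono) auto
  then show ?thesis using a_ge_1 by (simp add: field_simps flip: sum_distrib_left sum_divide_distrib)
qed

sublocale network n P w \<mu>
proof
  show "0 < n" using n2 by simp
  show "P \<subseteq> {(i, j). i < j \<and> j < n}" by (rule edges_sub)
  show "0 < w e" for e unfolding w_def by (rule dpsi_pos)
  show "0 < \<mu>" using \<Lambda>_pos a_ge_1 by (simp add: \<mu>_def)
  show "\<mu> * (\<Sum>i<n. (x i)\<^sup>2) \<le> energy P w x" if x: "(\<Sum>i<n. x i) = 0" for x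
  proof -
    have "\<Lambda> * (\<Sum>i<n. (x i)\<^sup>2) \<le> 4 * a * energy P w x"
      using lambda2_poincare[OF graph n2 x] grad_square_le_energy[of x] by (simp add: energy_def)
    then show ?thesis using a_ge_1 by (simp add: \<mu>_def field_simps)
  qed
qed

lemma energy_unit_lower:
  assumes "i < n"
  shows "m / (4 * a) \<le> \<E> (unit i)"
  using grad_square_le_energy[of "unit i"] degree_eq[OF graph(1) assms] degree_bounds(1)[OF assms, of E] a_ge_1
  by (simp add: field_simps)

text \<open>
  The bound of \<open>pointwise_test_vector\<close> on the energy of a test vector, with maximal weight
  \<open>1 / 4\<close>, gap \<open>\<mu>\<close> and weighted degree at least \<open>m / (4 * a)\<close>.
\<close>
definition Q :: real where "Q = 4 * a\<^sup>2 / (\<Lambda> * m)"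

lemma test_vectors:
  "\<exists>q. \<forall>i<n. \<E> (q i) \<le> Q \<and>
    (\<forall>x. (\<Sum>j<n. x j) = 0 \<longrightarrow> x i = H x i / \<E> (unit i) + (\<Sum>j<n. q i j * H x j))"
proof -
  have "\<exists>q. \<E> q \<le> Q \<and> (\<forall>x. (\<Sum>j<n. x j) = 0 \<longrightarrow> x i = H x i / \<E> (unit i) + (\<Sum>j<n. q j * H x j))"
    if i: "i < n" for i
  proof -
    have lower: "0 < m / (4 * a)" using m_pos a_ge_1 by simp
    then have D: "0 < \<E> (unit i)" using energy_unit_lower[OF i] by linarith
    obtain q where q: "\<E> q \<le> (1 / 4) / (\<mu> * \<E> (unit i))"
      "\<forall>x. (\<Sum>j<n. x j) = 0 \<longrightarrow> x i = H x i / \<E> (unit i) + (\<Sum>j<n. q j * H x j)"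
      using pointwise_test_vector[OF i _ w_bounds(2) D] by auto
    note q(1)
    also have "(1 / 4) / (\<mu> * \<E> (unit i)) \<le> (1 / 4) / (\<mu> * (m / (4 * a)))"
      using \<mu>_pos D lower energy_unit_lower[OF i] by (intro divide_left_mono mult_left_mono mult_pos_pos) auto
    also have "\<dots> = Q" using a_ge_1 by (simp add: Q_def \<mu>_def power2_eq_square)
    finally show ?thesis using q(2) by blast
  qed
  then show ?thesis by metis
qed

text \<open>
  This is where the lower bound on the algebraic connectivity enters: it makes the bound for a
  test vector as good as the worst-case bound \<open>16 * a\<^sup>2 * M / m\<^sup>2\<close> for \<open>unit i\<close> divided by its weighted
  degree.
\<close>
lemma test_vector_variance:
  assumes "\<E> q \<le> Q"
  shows "(\<Sum>e\<in>P. (grad q e)\<^sup>2) \<le> 8 * a\<^sup>2 * M / m\<^sup>2"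
proof -
  have "(\<Sum>e\<in>P. (grad q e)\<^sup>2) \<le> 4 * a * Q"
    using grad_square_le_energy[of q] mult_left_mono[OF assms, of "4 * a"] a_ge_1 by linarith
  also have "4 * a * Q = (16 * a ^ 3 / m) / \<Lambda>" by (simp add: Q_def eval_nat_numeral)
  also have "\<dots> \<le> (16 * a ^ 3 / m) / (2 * a\<^sup>2 * M / m)"
    using \<Lambda>_lower \<Lambda>_pos M_pos m_pos a_ge_1 by (intro divide_left_mono mult_pos_pos divide_pos_pos) auto
  also have "\<dots> = 8 * a / M" using a_ge_1 m_pos M_pos by (simp add: field_simps eval_nat_numeral)
  also have "\<dots> \<le> 8 * a\<^sup>2 * M / m\<^sup>2"
  proof -
    have "m\<^sup>2 \<le> M\<^sup>2" using m_pos m_le_M by (intro power_mono) auto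
    moreover have "a \<le> a\<^sup>2" using a_ge_1 by (simp add: power2_eq_square)
    ultimately have "a * m\<^sup>2 \<le> a\<^sup>2 * M\<^sup>2" using a_ge_1 by (intro mult_mono) auto
    then show ?thesis using m_pos M_pos by (simp add: field_simps power2_eq_square)
  qed
  finally show ?thesis .
qed

text \<open>
  The bound on the energy norm of the solution of \<open>H x = divg \<beta>\<close> that follows from the Euclidean
  bound on \<open>divg \<beta>\<close>.
\<close>
definition R :: real where "R = sqrt (4 * real n * M / L) / sqrt \<mu>"

lemma R_nonneg: "0 \<le> R"
  using M_pos \<mu>_pos by (simp add: R_def)

lemma Q_R_small: "sqrt Q * R \<le> 1 / 32"
proof -
  have "sqrt Q * R = sqrt (Q * (4 * real n * M / L) / \<mu>)"
    by (simp add: R_def real_sqrt_mult real_sqrt_divide)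
  also have "Q * (4 * real n * M / L) / \<mu> = 64 * a ^ 3 * n * M / (m * \<Lambda>\<^sup>2 * L)"
    using a_ge_1 \<Lambda>_pos by (simp add: Q_def \<mu>_def field_simps eval_nat_numeral)
  also have "sqrt \<dots> \<le> sqrt (1 / 1024)" using snr_bound by simp
  also have "sqrt (1 / 1024) = (1 / 32 :: real)" by (rule real_sqrt_unique) (auto simp: power2_eq_square)
  finally show ?thesis .
qed

lemma \<epsilon>_nonneg: "0 \<le> \<epsilon>"
  using n2 a_ge_1 M_pos by (simp add: \<epsilon>_def)

lemma scaled_noise_level: "sqrt (c * M * ln n / L) * (a / m) = sqrt c * \<epsilon>"
  using m_pos by (simp add: \<epsilon>_def real_sqrt_mult real_sqrt_divide)

text \<open>
  The three hypotheses on \<open>\<beta>\<close> are the events of high probability.  With \<open>\<rho> = 24 \<epsilon>\<close>, the two noise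
  terms take up \<open>7 \<epsilon> + 5 \<epsilon> = \<rho> / 2\<close> and the two remainder terms \<open>\<rho> / 4\<close> each.  The local remainder
  needs \<open>8 \<rho>\<^sup>2 \<le> \<rho> / 4\<close>, that is \<open>\<rho> \<le> 1 / 32\<close>, whence the threshold \<open>1 / 768\<close> on \<open>\<epsilon>\<close>.
\<close>
lemma perturbed_score_equation:
  fixes \<beta> :: "nat \<times> nat \<Rightarrow> real" and q :: "nat \<Rightarrow> nat \<Rightarrow> real"
  assumes small: "\<epsilon> \<le> 1 / 768"
    and q: "\<And>i. i < n \<Longrightarrow> \<E> (q i) \<le> Q"
      "\<And>i x. i < n \<Longrightarrow> (\<Sum>j<n. x j) = 0 \<Longrightarrow> x i = H x i / \<E> (unit i) + (\<Sum>j<n. q i j * H x j)"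
    and \<beta>2: "L2_set (divg P \<beta>) {..<n} \<le> sqrt (4 * real n * M / L)"
    and \<beta>1: "\<And>i. i < n \<Longrightarrow> \<bar>divg P \<beta> i\<bar> \<le> sqrt (3 * M * ln n / L)"
    and \<beta>q: "\<And>i. i < n \<Longrightarrow> \<bar>\<Sum>e\<in>P. \<beta> e * grad (q i) e\<bar> \<le> sqrt (3 * (8 * a\<^sup>2 * M / m\<^sup>2) * ln n / L)"
  shows "\<exists>d. (\<Sum>i<n. d i) = 0 \<and> (\<forall>i<n. \<bar>d i\<bar> \<le> 24 * \<epsilon>) \<and> N d \<le> 2 * R \<and>
    (\<forall>i<n. H d i = divg P (\<lambda>e. \<beta> e - psi_rem (grad \<theta> e) (grad d e)) i)"
proof (rule nonlinear_poisson_solvable)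
  define \<rho> where "\<rho> = 24 * \<epsilon>"
  have \<rho>: "0 \<le> \<rho>" "\<rho> \<le> 1 / 32" using \<epsilon>_nonneg small by (auto simp: \<rho>_def)
  have lip: "\<bar>psi_rem (grad \<theta> e) x - psi_rem (grad \<theta> e) y\<bar> \<le> 4 * \<rho> * w e * \<bar>x - y\<bar>"
    if "\<bar>x\<bar> \<le> 2 * \<rho>" "\<bar>y\<bar> \<le> 2 * \<rho>" for e x y
    using psi_rem_lipschitz[OF that, of "grad \<theta> e"] \<rho> by (simp add: w_def)
  show "0 \<le> 24 * \<epsilon>" using \<epsilon>_nonneg by simp
  show "0 \<le> R" by (rule R_nonneg)
  show "psi_rem (grad \<theta> e) 0 = 0" for e by simp
  show "continuous_on UNIV (psi_rem (grad \<theta> e))" for e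
  proof -
    have "isCont psi t" for t using psi_has_derivative by (rule DERIV_isCont)
    then have "continuous_on UNIV psi" by (simp add: continuous_at_imp_continuous_on)
    then have "continuous_on UNIV (\<lambda>x. psi (grad \<theta> e + x))"
      by (rule continuous_on_compose2) (auto intro!: continuous_intros)
    then show ?thesis unfolding psi_rem_def by (intro continuous_intros)
  qed
  show "\<bar>psi_rem (grad \<theta> e) x - psi_rem (grad \<theta> e) y\<bar> \<le> 1 / 2 * w e * \<bar>x - y\<bar>"
    if "e \<in> P" "\<bar>x\<bar> \<le> 2 * (24 * \<epsilon>)" "\<bar>y\<bar> \<le> 2 * (24 * \<epsilon>)" for e x y
  proof -
    have "\<bar>psi_rem (grad \<theta> e) x - psi_rem (grad \<theta> e) y\<bar> \<le> 4 * \<rho> * w e * \<bar>x - y\<bar>"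
      using that by (intro lip) (auto simp: \<rho>_def)
    also have "\<dots> \<le> 1 / 2 * w e * \<bar>x - y\<bar>"
      using \<rho> w_pos[OF that(1)] by (intro mult_right_mono) auto
    finally show ?thesis .
  qed
  show "\<bar>\<Sum>e\<in>P. \<beta> e * grad x e\<bar> \<le> R * N x" if x: "(\<Sum>i<n. x i) = 0" for x
  proof -
    have "\<bar>\<Sum>e\<in>P. \<beta> e * grad x e\<bar> = \<bar>\<Sum>i<n. x i * divg P \<beta> i\<bar>" by (simp add: sum_divg[OF P_sub'])
    also have "\<dots> \<le> (\<Sum>i<n. \<bar>x i\<bar> * \<bar>divg P \<beta> i\<bar>)" by (rule order_trans[OF sum_abs]) (simp add: abs_mult)
    also have "\<dots> \<le> L2_set x {..<n} * L2_set (divg P \<beta>) {..<n}" by (rule L2_set_mult_ineq)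
    also have "\<dots> \<le> (N x / sqrt \<mu>) * sqrt (4 * real n * M / L)"
      using \<mu>_pos energy_nonneg by (intro mult_mono norm_le_energy x \<beta>2) auto
    finally show ?thesis by (simp add: R_def mult.commute)
  qed
  fix x d :: "nat \<Rightarrow> real" and i
  assume x: "(\<Sum>i<n. x i) = 0" and d: "\<forall>i<n. \<bar>d i\<bar> \<le> 24 * \<epsilon>" "N d \<le> 2 * R" and i: "i < n"
    and Hx: "\<forall>i<n. H x i = divg P (\<lambda>e. \<beta> e - psi_rem (grad \<theta> e) (grad d e)) i"
  define f where "f = (\<lambda>e. psi_rem (grad \<theta> e) (grad d e))"
  define D where "D = \<E> (unit i)"
  have D: "m / (4 * a) \<le> D" unfolding D_def by (rule energy_unit_lower[OF i])
  have Dpos: "0 < D" by (rule less_le_trans[OF _ D]) (use m_pos a_ge_1 in simp)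
  have gd: "\<bar>grad d e\<bar> \<le> 2 * \<rho>" if eP: "e \<in> P" for e
  proof -
    obtain j k where e: "e = (j, k)" "j < n" "k < n" using eP P_sub' by auto
    then have "\<bar>d j\<bar> \<le> \<rho>" "\<bar>d k\<bar> \<le> \<rho>" using d by (auto simp: \<rho>_def)
    then show ?thesis by (simp add: e grad_def)
  qed
  have f: "\<bar>f e\<bar> \<le> 4 * \<rho> * w e * \<bar>grad d e\<bar>" if "e \<in> P" for e
    using lip[OF gd[OF that], of 0 e] \<rho> by (simp add: f_def)
  have "x i = (divg P \<beta> i - divg P f i) / D + (\<Sum>j<n. q i j * divg P (\<lambda>e. \<beta> e - f e) j)"
    using q(2)[OF i x] Hx i by (simp add: D_def f_def divg_diff)
  also have "(\<Sum>j<n. q i j * divg P (\<lambda>e. \<beta> e - f e) j) = (\<Sum>e\<in>P. \<beta> e * grad (q i) e) - (\<Sum>e\<in>P. f e * grad (q i) e)"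
    by (simp add: sum_divg[OF P_sub'] left_diff_distrib sum_subtractf)
  finally have xi: "x i = divg P \<beta> i / D - divg P f i / D
      + ((\<Sum>e\<in>P. \<beta> e * grad (q i) e) - (\<Sum>e\<in>P. f e * grad (q i) e))"
    by (simp add: diff_divide_distrib)
  have t1: "\<bar>divg P \<beta> i / D\<bar> \<le> 7 * \<epsilon>"
  proof -
    have "\<bar>divg P \<beta> i / D\<bar> \<le> sqrt (3 * M * ln n / L) / (m / (4 * a))"
      unfolding abs_divide using \<beta>1[OF i] D Dpos m_pos M_pos n2 a_ge_1 by (intro frac_le) auto
    also have "\<dots> = 4 * (sqrt 3 * \<epsilon>)" unfolding scaled_noise_level[symmetric] by simp
    also have "\<dots> \<le> 7 * \<epsilon>"
    proof -
      have "sqrt 3 \<le> 7 / 4" by (rule real_le_lsqrt) (auto simp: power2_eq_square)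
      then have "sqrt 3 * \<epsilon> \<le> 7 / 4 * \<epsilon>" using \<epsilon>_nonneg by (rule mult_right_mono)
      then show ?thesis by simp
    qed
    finally show ?thesis .
  qed
  have t2: "\<bar>divg P f i / D\<bar> \<le> \<rho> / 4"
  proof -
    have "\<bar>divg P f i\<bar> \<le> (\<Sum>e\<in>P. \<bar>f e\<bar> * \<bar>grad (unit i) e\<bar>)"
      unfolding divg_def by (rule order_trans[OF sum_abs]) (simp add: abs_mult)
    also have "\<dots> \<le> (\<Sum>e\<in>P. 8 * \<rho>\<^sup>2 * (w e * (grad (unit i) e)\<^sup>2))"
    proof (rule sum_mono)
      fix e assume e: "e \<in> P"
      have "0 \<le> 4 * \<rho> * w e" using \<rho>(1) w_pos[OF e] by simp
      from order_trans[OF f[OF e] mult_left_mono[OF gd[OF e] this]]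
      have "\<bar>f e\<bar> \<le> 4 * \<rho> * w e * (2 * \<rho>)" .
      moreover have "\<bar>grad (unit i) e\<bar> = (grad (unit i) e)\<^sup>2"
        by (auto simp: grad_def unit_def split: prod.splits)
      ultimately show "\<bar>f e\<bar> * \<bar>grad (unit i) e\<bar> \<le> 8 * \<rho>\<^sup>2 * (w e * (grad (unit i) e)\<^sup>2)"
        using mult_right_mono[of "\<bar>f e\<bar>" "4 * \<rho> * w e * (2 * \<rho>)" "(grad (unit i) e)\<^sup>2"]
        by (simp add: power2_eq_square mult_ac)
    qed
    also have "\<dots> = 8 * \<rho>\<^sup>2 * D" by (simp add: D_def energy_def sum_distrib_left)
    finally have "\<bar>divg P f i / D\<bar> \<le> 8 * \<rho>\<^sup>2" using Dpos by (simp add: pos_divide_le_eq)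
    also have "8 * \<rho>\<^sup>2 \<le> \<rho> / 4"
      using mult_left_mono[OF \<rho>(2) \<rho>(1)] by (simp add: power2_eq_square)
    finally show ?thesis .
  qed
  have t3: "\<bar>\<Sum>e\<in>P. \<beta> e * grad (q i) e\<bar> \<le> 5 * \<epsilon>"
  proof -
    have "sqrt (3 * (8 * a\<^sup>2 * M / m\<^sup>2) * ln n / L) = sqrt (24 * M * ln n / L) * (a / m)"
    proof -
      have "3 * (8 * a\<^sup>2 * M / m\<^sup>2) * ln n / L = (24 * M * ln n / L) * (a / m)\<^sup>2"
        by (simp add: power_divide mult_ac)
      then show ?thesis using a_ge_1 m_pos by (simp only: real_sqrt_mult real_sqrt_abs) simp
    qed
    also have "\<dots> = sqrt 24 * \<epsilon>" by (rule scaled_noise_level)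
    also have "\<dots> \<le> 5 * \<epsilon>"
      by (intro mult_right_mono \<epsilon>_nonneg real_le_lsqrt) (auto simp: power2_eq_square)
    finally show ?thesis using \<beta>q[OF i] by linarith
  qed
  have t4: "\<bar>\<Sum>e\<in>P. f e * grad (q i) e\<bar> \<le> \<rho> / 4"
  proof -
    have "\<bar>\<Sum>e\<in>P. f e * grad (q i) e\<bar> \<le> 4 * \<rho> * N (q i) * N d"
      using \<rho> f w_pos by (intro flow_cauchy_schwarz) (auto intro: less_imp_le)
    also have "\<dots> \<le> 4 * \<rho> * sqrt Q * (2 * R)"
      using \<rho> d(2) q(1)[OF i] energy_nonneg Q_def \<Lambda>_pos m_pos by (intro mult_mono) auto
    also have "\<dots> = 8 * \<rho> * (sqrt Q * R)" by simp
    also have "\<dots> \<le> 8 * \<rho> * (1 / 32)" using \<rho> by (intro mult_left_mono Q_R_small) auto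
    finally show ?thesis by simp
  qed
  show "\<bar>x i\<bar> \<le> 24 * \<epsilon>"
    using t1 t2 t3 t4 unfolding xi \<rho>_def by linarith
qed

lemma mle_bounds:
  assumes small: "\<epsilon> \<le> 1 / 768"
    and sum0: "(\<Sum>i<n. \<theta> i) = 0"
    and q: "\<And>i. i < n \<Longrightarrow> \<E> (q i) \<le> Q"
      "\<And>i x. i < n \<Longrightarrow> (\<Sum>j<n. x j) = 0 \<Longrightarrow> x i = H x i / \<E> (unit i) + (\<Sum>j<n. q i j * H x j)"
    and \<beta>2: "L2_set (divg P (noise L \<theta> y)) {..<n} \<le> sqrt (4 * real n * M / L)"
    and \<beta>1: "\<And>i. i < n \<Longrightarrow> \<bar>divg P (noise L \<theta> y) i\<bar> \<le> sqrt (3 * M * ln n / L)"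
    and \<beta>q: "\<And>i. i < n \<Longrightarrow> \<bar>\<Sum>e\<in>P. noise L \<theta> y e * grad (q i) e\<bar> \<le> sqrt (3 * (8 * a\<^sup>2 * M / m\<^sup>2) * ln n / L)"
  shows "(\<exists>\<theta>'. is_mle n E L y \<theta>') \<and>
    (\<forall>\<theta>'. is_mle n E L y \<theta>' \<longrightarrow>
      linf_dist n \<theta>' \<theta> \<le> 24 * \<epsilon> \<and> l2_dist n \<theta>' \<theta> \<le> 16 * l2_rate n E L \<theta>)"
proof -
  obtain d where d: "(\<Sum>i<n. d i) = 0" "\<forall>i<n. \<bar>d i\<bar> \<le> 24 * \<epsilon>" "N d \<le> 2 * R"
    "\<forall>i<n. H d i = divg P (\<lambda>e. noise L \<theta> y e - psi_rem (grad \<theta> e) (grad d e)) i"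
    using perturbed_score_equation[OF small q \<beta>2 \<beta>1 \<beta>q] by auto
  define \<eta> where "\<eta> = (\<lambda>i. \<theta> i + d i)"
  have g: "grad \<eta> e = grad \<theta> e + grad d e" for e
    by (simp add: \<eta>_def grad_def split: prod.splits)
  have sum\<eta>: "(\<Sum>i<n. \<eta> i) = 0" using d sum0 by (simp add: \<eta>_def sum.distrib)
  have score: "divg P (\<lambda>e. psi (grad \<eta> e) - ybar L y (fst e) (snd e)) i = 0" if i: "i < n" for i
  proof -
    have "psi (grad \<eta> e) - ybar L y (fst e) (snd e)
        = w e * grad d e - (noise L \<theta> y e - psi_rem (grad \<theta> e) (grad d e))" for e
      by (simp add: g psi_rem_def w_def noise_eq)
    then have "divg P (\<lambda>e. psi (grad \<eta> e) - ybar L y (fst e) (snd e)) i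
        = H d i - divg P (\<lambda>e. noise L \<theta> y e - psi_rem (grad \<theta> e) (grad d e)) i"
      by (simp only: divg_diff[where f = "\<lambda>e. w e * grad d e"] lap_def)
    then show ?thesis using d(4) i by simp
  qed
  have mle: "is_mle n E L y \<eta>"
    by (rule score_zero_imp_unique_mle(1)[OF graph n_pos sum\<eta> score])
  have unique: "\<theta>' i = \<eta> i" if "is_mle n E L y \<theta>'" "i < n" for \<theta>' i
    by (rule score_zero_imp_unique_mle(2)[OF graph n_pos sum\<eta> score that])
  have "linf_dist n \<theta>' \<theta> \<le> 24 * \<epsilon> \<and> l2_dist n \<theta>' \<theta> \<le> 16 * l2_rate n E L \<theta>" if "is_mle n E L y \<theta>'" for \<theta>'
  proof
    have diff: "\<theta>' i - \<theta> i = d i" if "i < n" for i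
      using unique[OF \<open>is_mle n E L y \<theta>'\<close> that] by (simp add: \<eta>_def)
    show "linf_dist n \<theta>' \<theta> \<le> 24 * \<epsilon>"
      unfolding linf_dist_def using n_pos d(2) diff by (intro Max.boundedI) auto
    have "l2_dist n \<theta>' \<theta> = L2_set d {..<n}"
      unfolding l2_dist_def by (intro L2_set_cong) (auto simp: diff)
    also have "\<dots> \<le> N d / sqrt \<mu>" by (rule norm_le_energy[OF d(1)])
    also have "\<dots> \<le> 2 * R / sqrt \<mu>" using \<mu>_pos d(3) by (intro divide_right_mono) auto
    also have "\<dots> = 2 * sqrt (4 * (M * n / L)) / \<mu>"
      using \<mu>_pos by (simp add: R_def mult_ac)
    also have "\<dots> = 16 * l2_rate n E L \<theta>"
      using \<Lambda>_pos a_ge_1 unfolding real_sqrt_mult by (simp add: l2_rate_def \<mu>_def a_def mult_ac)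
    finally show "l2_dist n \<theta>' \<theta> \<le> 16 * l2_rate n E L \<theta>" .
  qed
  with mle show ?thesis by blast
qed

lemma mle_bounds_probability:
  assumes small: "\<epsilon> \<le> 1 / 768" and sum0: "(\<Sum>i<n. \<theta> i) = 0"
  shows "measure_pmf.prob (btl_pmf n E L \<theta>)
    {y. (\<exists>\<theta>'. is_mle n E L y \<theta>') \<and>
        (\<forall>\<theta>'. is_mle n E L y \<theta>' \<longrightarrow>
          linf_dist n \<theta>' \<theta> \<le> 24 * \<epsilon> \<and> l2_dist n \<theta>' \<theta> \<le> 16 * l2_rate n E L \<theta>)}
    \<ge> 1 - 3129 / real n ^ 5" (is "measure_pmf.prob ?p ?G \<ge> _")
proof -
  obtain q where q: "\<And>i. i < n \<Longrightarrow> \<E> (q i) \<le> Q"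
      "\<And>i x. i < n \<Longrightarrow> (\<Sum>j<n. x j) = 0 \<Longrightarrow> x i = H x i / \<E> (unit i) + (\<Sum>j<n. q i j * H x j)"
    using test_vectors by blast
  let ?S = "8 * a\<^sup>2 * M / m\<^sup>2"
  define B1 where "B1 = {y. sqrt (4 * real n * M / L) < L2_set (divg P (noise L \<theta> y)) {..<n}}"
  define B2 where "B2 = {y. \<exists>i<n. sqrt (3 * M * ln n / L) < \<bar>\<Sum>e\<in>P. grad (unit i) e * noise L \<theta> y e\<bar>}"
  define B3 where "B3 = {y. \<exists>i<n. sqrt (3 * ?S * ln n / L) < \<bar>\<Sum>e\<in>P. grad (q i) e * noise L \<theta> y e\<bar>}"
  have b1: "measure_pmf.prob ?p B1 \<le> 3125 / real n ^ 5"
    unfolding B1_def by (rule noise_divg_norm_tail[OF L_pos n2 graph(1) M_pos])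
  have b2: "measure_pmf.prob ?p B2 \<le> 2 / real n ^ 5"
    unfolding B2_def using degree_eq[OF graph(1)] degree_bounds(2)
    by (intro noise_tail_union L_pos n2 M_pos) auto
  have b3: "measure_pmf.prob ?p B3 \<le> 2 / real n ^ 5"
    unfolding B3_def using a_ge_1 m_pos M_pos
    by (intro noise_tail_union L_pos n2 test_vector_variance q(1)) auto
  have "measure_pmf.prob ?p (B1 \<union> B2 \<union> B3) \<le> measure_pmf.prob ?p (B1 \<union> B2) + measure_pmf.prob ?p B3"
    by (rule measure_Un_le) auto
  also have "measure_pmf.prob ?p (B1 \<union> B2) \<le> measure_pmf.prob ?p B1 + measure_pmf.prob ?p B2"
    by (rule measure_Un_le) auto
  finally have "measure_pmf.prob ?p (B1 \<union> B2 \<union> B3) \<le> 3125 / real n ^ 5 + 2 / real n ^ 5 + 2 / real n ^ 5"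
    using b1 b2 b3 by linarith
  moreover have "measure_pmf.prob ?p (- (B1 \<union> B2 \<union> B3)) = 1 - measure_pmf.prob ?p (B1 \<union> B2 \<union> B3)"
    using measure_pmf.prob_compl[of "B1 \<union> B2 \<union> B3" ?p] by (simp add: Compl_eq_Diff_UNIV[symmetric])
  moreover have "measure_pmf.prob ?p (- (B1 \<union> B2 \<union> B3)) \<le> measure_pmf.prob ?p ?G"
  proof (rule measure_pmf.finite_measure_mono)
    show "- (B1 \<union> B2 \<union> B3) \<subseteq> ?G"
    proof
      fix y assume y: "y \<in> - (B1 \<union> B2 \<union> B3)"
      have "(\<exists>\<theta>'. is_mle n E L y \<theta>') \<and>
        (\<forall>\<theta>'. is_mle n E L y \<theta>' \<longrightarrow>
          linf_dist n \<theta>' \<theta> \<le> 24 * \<epsilon> \<and> l2_dist n \<theta>' \<theta> \<le> 16 * l2_rate n E L \<theta>)"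
      proof (rule mle_bounds[OF small sum0 q])
        show "L2_set (divg P (noise L \<theta> y)) {..<n} \<le> sqrt (4 * real n * M / L)"
          using y by (simp add: B1_def not_less)
        show "\<bar>divg P (noise L \<theta> y) i\<bar> \<le> sqrt (3 * M * ln n / L)" if "i < n" for i
        proof -
          have "y \<notin> B2" using y by simp
          then have "\<bar>\<Sum>e\<in>P. grad (unit i) e * noise L \<theta> y e\<bar> \<le> sqrt (3 * M * ln n / L)"
            using that unfolding B2_def mem_Collect_eq by (meson not_less)
          then show ?thesis by (simp only: divg_def mult.commute[of "noise L \<theta> y _"])
        qed
        show "\<bar>\<Sum>e\<in>P. noise L \<theta> y e * grad (q i) e\<bar> \<le> sqrt (3 * ?S * ln n / L)" if "i < n" for i
        proof -
          have "y \<notin> B3" using y by simp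
          then have "\<bar>\<Sum>e\<in>P. grad (q i) e * noise L \<theta> y e\<bar> \<le> sqrt (3 * ?S * ln n / L)"
            using that unfolding B3_def mem_Collect_eq by (meson not_less)
          then show ?thesis by (simp only: mult.commute[of "noise L \<theta> y _"])
        qed
      qed
      then show "y \<in> ?G" by blast
    qed
  qed simp
  ultimately show ?thesis by simp
qed

end

theorem theorem21:
  fixes K :: real
  assumes "K > 0"
  shows "\<exists>C>0. \<exists>c>0. \<exists>C\<^sub>i>0. \<exists>C\<^sub>2>0. \<exists>C\<^sub>p>0.
    \<forall>(n::nat) (L::nat) (E::(nat \<times> nat) set) (\<theta>::nat \<Rightarrow> real).
      n \<ge> 2 \<longrightarrow>
      simple_graph n E \<longrightarrow>
      connected_graph n E \<longrightarrow>
      (\<Sum>i<n. \<theta> i) = 0 \<longrightarrow>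
      (lambda2 n E)\<^sup>2 * real L
        > C * exp (2 * kappa_E E \<theta>)
            * max (n_max n E * ln (real n))
                  (exp (2 * kappa_E E \<theta>) * real n * ((n_max n E)\<^sup>2 / (n_min n E)\<^sup>2)) \<longrightarrow>
      lambda2 n E \<ge> 2 * exp (2 * kappa_E E \<theta>) * n_max n E / n_min n E \<longrightarrow>
      real L \<le> K * real n ^ 5 \<longrightarrow>
      kappa n \<theta> < real n \<longrightarrow>
      kappa_E E \<theta> \<le> ln (real n) \<longrightarrow>
      linf_rate n E L \<theta> < c \<longrightarrow>
      measure_pmf.prob (btl_pmf n E L \<theta>)
        {y. (\<exists>\<theta>'. is_mle n E L y \<theta>') \<and>
            (\<forall>\<theta>'. is_mle n E L y \<theta>' \<longrightarrow>
               linf_dist n \<theta>' \<theta> \<le> C\<^sub>i * linf_rate n E L \<theta> \<and>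
               l2_dist n \<theta>' \<theta> \<le> C\<^sub>2 * l2_rate n E L \<theta>)}
        \<ge> 1 - C\<^sub>p / real n ^ 5"
proof (intro exI conjI allI impI)
  fix n L :: nat and E \<theta>
  assume n: "n \<ge> 2" and graph: "simple_graph n E" "connected_graph n E"
    and sum0: "(\<Sum>i<n. \<theta> i) = 0"
    and snr: "(lambda2 n E)\<^sup>2 * real L
        > 65536 * exp (2 * kappa_E E \<theta>)
            * max (n_max n E * ln (real n))
                  (exp (2 * kappa_E E \<theta>) * real n * ((n_max n E)\<^sup>2 / (n_min n E)\<^sup>2))"
    and gap: "lambda2 n E \<ge> 2 * exp (2 * kappa_E E \<theta>) * n_max n E / n_min n E"
    and rate: "linf_rate n E L \<theta> < 1 / 768"
  have "65536 * exp (2 * kappa_E E \<theta>) * (exp (2 * kappa_E E \<theta>) * n * ((n_max n E)\<^sup>2 / (n_min n E)\<^sup>2))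
      \<le> 65536 * exp (2 * kappa_E E \<theta>) * max (n_max n E * ln (real n))
          (exp (2 * kappa_E E \<theta>) * real n * ((n_max n E)\<^sup>2 / (n_min n E)\<^sup>2))"
    by (intro mult_left_mono max.cobounded2) simp
  with snr have "(lambda2 n E)\<^sup>2 * real L
      > 65536 * exp (2 * kappa_E E \<theta>) * (exp (2 * kappa_E E \<theta>) * n * ((n_max n E)\<^sup>2 / (n_min n E)\<^sup>2))"
    by (rule le_less_trans[rotated])
  then interpret btl_design n L E \<theta>
    using n graph gap by unfold_locales
  have s: "0 \<le> s_ratio n E \<theta>"
    unfolding s_ratio_def using M_pos m_pos \<Lambda>_pos by simp
  have "0 \<le> s_ratio n E \<theta> * sqrt (n_max n E / real L)
       * (1 + exp (kappa_E E \<theta>) * sqrt (ln (real n)) / n_min n E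
            + s_ratio n E \<theta> * sqrt (real n / n_max n E))"
    using s M_pos m_pos n by (intro mult_nonneg_nonneg add_nonneg_nonneg divide_nonneg_nonneg) auto
  then have le: "\<epsilon> \<le> linf_rate n E L \<theta>"
    by (simp add: \<epsilon>_def a_def linf_rate_def)
  have "1 - 3129 / real n ^ 5 \<le> measure_pmf.prob (btl_pmf n E L \<theta>)
    {y. (\<exists>\<theta>'. is_mle n E L y \<theta>') \<and>
        (\<forall>\<theta>'. is_mle n E L y \<theta>' \<longrightarrow>
          linf_dist n \<theta>' \<theta> \<le> 24 * \<epsilon> \<and> l2_dist n \<theta>' \<theta> \<le> 16 * l2_rate n E L \<theta>)}"
    using le rate by (intro mle_bounds_probability sum0) simp
  also have "\<dots> \<le> measure_pmf.prob (btl_pmf n E L \<theta>)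
    {y. (\<exists>\<theta>'. is_mle n E L y \<theta>') \<and>
        (\<forall>\<theta>'. is_mle n E L y \<theta>' \<longrightarrow>
          linf_dist n \<theta>' \<theta> \<le> 24 * linf_rate n E L \<theta> \<and> l2_dist n \<theta>' \<theta> \<le> 16 * l2_rate n E L \<theta>)}"
  proof (rule measure_pmf.finite_measure_mono)
    have weaken: "x \<le> 24 * linf_rate n E L \<theta>" if "x \<le> 24 * \<epsilon>" for x
      using that le by linarith
    show "{y. (\<exists>\<theta>'. is_mle n E L y \<theta>') \<and>
        (\<forall>\<theta>'. is_mle n E L y \<theta>' \<longrightarrow>
          linf_dist n \<theta>' \<theta> \<le> 24 * \<epsilon> \<and> l2_dist n \<theta>' \<theta> \<le> 16 * l2_rate n E L \<theta>)}
      \<subseteq> {y. (\<exists>\<theta>'. is_mle n E L y \<theta>') \<and>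
        (\<forall>\<theta>'. is_mle n E L y \<theta>' \<longrightarrow>
          linf_dist n \<theta>' \<theta> \<le> 24 * linf_rate n E L \<theta> \<and> l2_dist n \<theta>' \<theta> \<le> 16 * l2_rate n E L \<theta>)}"
      by (intro Collect_mono) (blast intro: weaken)
  qed simp
  finally show "1 - 3129 / real n ^ 5 \<le> measure_pmf.prob (btl_pmf n E L \<theta>)
    {y. (\<exists>\<theta>'. is_mle n E L y \<theta>') \<and>
        (\<forall>\<theta>'. is_mle n E L y \<theta>' \<longrightarrow>
          linf_dist n \<theta>' \<theta> \<le> 24 * linf_rate n E L \<theta> \<and> l2_dist n \<theta>' \<theta> \<le> 16 * l2_rate n E L \<theta>)}" .
qed simp_all

end
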